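(* Let $k>\ell\geq 1$ be integers. Then $$C(C_{2k+1},C_{2\ell+1})\leq\begin{cases}\frac{2(k+1)}{2\ell+1} & \text{if } k\leq 2\ell-1,\\[2pt] \frac{2k(2k-2\ell+1)-1}{2\ell(2k-2\ell+1)-1} & \text{if } k\geq 2\ell.\end{cases}$$
   Context: All graphs are finite and simple. $C_m$ denotes the cycle on $m$ vertices. $\operatorname{hom}(H,T)$ is the number of maps $V(H)\to V(T)$ sending every edge of $H$ to an edge of $T$, $t(H,T)=\operatorname{hom}(H,T)/v(T)^{v(H)}$, and $C(G,H)=\min\{c\in\mathbb{R}: t(G,T)\geq t(H,T)^c \text{ for all graphs } T\}$. *)

theory Defs
  imports Complex_Main "HOL-Library.FuncSet" "Graph_Theory.Pair_Digraph"
begin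

text \<open>
  A finite simple graph is a \<^locale>\<open>pair_graph\<close>, i.e. a finite loop-free symmetric digraph
  whose arcs are ordered pairs of vertices; each edge corresponds to two opposite arcs.
\<close>

definition cycle_graph :: "nat \<Rightarrow> nat pair_pre_digraph" where
  "cycle_graph m = \<lparr> pverts = {..<m},
     parcs = {(i, j). i < m \<and> j < m \<and> (j = Suc i mod m \<or> i = Suc j mod m)} \<rparr>"

text \<open>Extensional functions make the number of maps on the vertex set finite.\<close>

definition graph_homs :: "'a pair_pre_digraph \<Rightarrow> 'b pair_pre_digraph \<Rightarrow> ('a \<Rightarrow> 'b) set" where
  "graph_homs H T = {f \<in> pverts H \<rightarrow>\<^sub>E pverts T. \<forall>(u, v) \<in> parcs H. (f u, f v) \<in> parcs T}"

definition hom_count :: "'a pair_pre_digraph \<Rightarrow> 'b pair_pre_digraph \<Rightarrow> nat" where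
  "hom_count H T = card (graph_homs H T)"

definition hom_density :: "'a pair_pre_digraph \<Rightarrow> 'b pair_pre_digraph \<Rightarrow> real" where
  "hom_density H T = real (hom_count H T) / real (card (pverts T)) ^ card (pverts H)"

text \<open>
  The targets \<open>T\<close> range over nonempty graphs, as the density is a quotient by \<open>v(T)\<close>; since
  densities are invariant under isomorphism of \<open>T\<close>, vertices in \<^typ>\<open>nat\<close> cover all
  finite graphs.  Note \<open>0 powr c = 0\<close> for every \<open>c\<close>.  This does not affect the minimum when
  \<open>G\<close> and \<open>H\<close> have edges: a large complete graph \<open>T\<close> has both densities strictly
  between 0 and 1, which already excludes every \<open>c \<le> 0\<close>.
\<close>

definition domination_exponent ::
    "'a pair_pre_digraph \<Rightarrow> 'b pair_pre_digraph \<Rightarrow> real" where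
  "domination_exponent G H = (LEAST c. \<forall>T :: nat pair_pre_digraph.
     pair_graph T \<and> pverts T \<noteq> {} \<longrightarrow> hom_density G T \<ge> hom_density H T powr c)"

lemma pair_graph_cycle_graph:
  assumes "m \<ge> 3"
  shows "pair_graph (cycle_graph m)"
proof
  fix e assume e: "e \<in> parcs (cycle_graph m)"
  show "fst e \<in> pverts (cycle_graph m)" "snd e \<in> pverts (cycle_graph m)"
    using e by (auto simp: cycle_graph_def)
  show "fst e \<noteq> snd e"
    using e assms by (auto simp: cycle_graph_def mod_Suc split: if_splits)
next
  show "finite (pverts (cycle_graph m))" by (simp add: cycle_graph_def)
  show "finite (parcs (cycle_graph m))"
    by (rule finite_subset[of _ "{..<m} \<times> {..<m}"]) (auto simp: cycle_graph_def)
  show "symmetric (with_proj (cycle_graph m))"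
    by (auto simp: symmetric_def sym_def cycle_graph_def)
qed

end

theory Submission
  imports Defs "HOL-Analysis.Convex" "HOL-Analysis.Elementary_Metric_Spaces"
begin

text \<open>
  Write \<open>t\<^sub>m\<close> for the density of \<open>C\<^sub>m\<close>, i.e. the trace of the \<open>m\<close>-th power of the adjacency matrix
  divided by \<open>v(T)\<close>, and \<open>p = t\<^sub>2\<close> for the edge density.  Let \<open>M = 2 k - 2 l + 1\<close> and
  \<open>j = k - l + 1\<close>.

  The Blakley--Roy inequality gives \<open>t\<^bsub>2k+1\<^esub> t\<^bsub>2l\<^esub>\<^bsup>M-1\<^esup> \<ge> t\<^bsub>2l+1\<^esub>\<^bsup>M\<^esup>\<close>.  If every edge lies in about the
  same number of copies of \<open>C\<^bsub>2l+1\<^esub>\<close>, gluing \<open>C\<^bsub>2l+1\<^esub>\<close> and \<open>C\<^bsub>2j\<^esub>\<close> along an edge gives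
  \<open>t\<^bsub>2k+1\<^esub> \<ge> t\<^bsub>2l+1\<^esub> t\<^bsub>2j\<^esub> / p\<close>.  Combined with \<open>t\<^bsub>2j\<^esub> \<ge> p\<^bsup>2j\<^esup>\<close>, the log-convexity of
  \<open>i \<mapsto> t\<^bsub>2i\<^esub>\<close>, and the monotonicity of the norms \<open>t\<^sub>m\<^bsup>1/m\<^esup>\<close>, these yield the exponents.

  The regularity of the edges is obtained by deleting edges that lie in few copies of
  \<open>C\<^bsub>2l+1\<^esub>\<close>.  This costs a factor that is subexponential under tensor powers of \<open>T\<close>, so it
  disappears when the inequality is applied to \<open>T\<^bsup>\<otimes>N\<^esup>\<close> and \<open>N \<rightarrow> \<infinity>\<close>.
\<close>

section \<open>The Blakley--Roy inequality\<close>

text \<open>Jensen's inequality for \<open>ln\<close> with weights that need not be normalised: the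
  tangent of \<open>ln\<close> at the weighted mean \<open>a\<close> lies above
  \<open>ln\<close>.\<close>

lemma weighted_sum_ln_le:
  fixes w t :: "'a \<Rightarrow> real"
  assumes "finite S" and w: "\<And>i. i \<in> S \<Longrightarrow> w i \<ge> 0" and t: "\<And>i. i \<in> S \<Longrightarrow> t i > 0"
    and Z: "sum w S > 0"
  shows "(\<Sum>i\<in>S. w i * ln (t i)) \<le> sum w S * ln ((\<Sum>i\<in>S. w i * t i) / sum w S)"
proof -
  define Z where "Z = sum w S"
  define a where "a = (\<Sum>i\<in>S. w i * t i) / Z"
  obtain i where i: "i \<in> S" "w i > 0"
    using Z sum_nonpos[of S w] by (meson not_le)
  have "(\<Sum>i\<in>S. w i * t i) > 0"
    by (rule sum_pos2[OF assms(1) i(1)])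
      (use i t w in \<open>auto intro!: mult_pos_pos mult_nonneg_nonneg less_imp_le[OF t]\<close>)
  then have a: "a > 0" using Z by (simp add: a_def Z_def)
  have "(\<Sum>i\<in>S. w i * ln (t i)) \<le> (\<Sum>i\<in>S. w i * (t i / a - 1 + ln a))"
  proof (intro sum_mono mult_left_mono w)
    fix i assume i: "i \<in> S"
    have "ln (t i / a) \<le> t i / a - 1"
      using ln_le_minus_one[of "t i / a"] t[OF i] a by simp
    then show "ln (t i) \<le> t i / a - 1 + ln a"
      using t[OF i] a by (simp add: ln_div)
  qed
  also have "\<dots> = (\<Sum>i\<in>S. w i * t i) / a - Z + Z * ln a"
    by (simp add: algebra_simps sum.distrib sum_subtractf sum_divide_distrib Z_def
        flip: sum_distrib_left)
  also have "(\<Sum>i\<in>S. w i * t i) / a = Z"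
    using a Z by (simp add: a_def Z_def field_simps)
  finally show ?thesis by (simp add: a_def Z_def)
qed

primrec kernel_iter :: "'a set \<Rightarrow> ('a \<Rightarrow> 'a \<Rightarrow> real) \<Rightarrow> ('a \<Rightarrow> real) \<Rightarrow> nat \<Rightarrow> 'a \<Rightarrow> real" where
  "kernel_iter S B x 0 = x"
| "kernel_iter S B x (Suc n) = (\<lambda>i. \<Sum>j\<in>S. B i j * kernel_iter S B x n j)"

text \<open>
  With \<open>y = B x\<close>, the weights \<open>x\<^sub>i y\<^sub>i\<close> form a stationary measure of the Markov chain with
  transition probabilities \<open>B\<^sub>i\<^sub>j x\<^sub>j / y\<^sub>i\<close>; hence the averages of \<open>ln ((B\<^sup>t x)\<^sub>i / x\<^sub>i)\<close> against
  it are superadditive in \<open>t\<close>.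
\<close>

lemma Blakley_Roy_pos:
  assumes fin: "finite S" and ne: "S \<noteq> {}"
    and x: "\<And>i. i \<in> S \<Longrightarrow> x i > 0"
    and B: "\<And>i j. i \<in> S \<Longrightarrow> j \<in> S \<Longrightarrow> B i j > 0"
    and sym: "\<And>i j. i \<in> S \<Longrightarrow> j \<in> S \<Longrightarrow> B i j = B j i"
  shows "(\<Sum>i\<in>S. x i * kernel_iter S B x 1 i) ^ Suc m \<le>
    (\<Sum>i\<in>S. x i * kernel_iter S B x (Suc m) i) * (\<Sum>i\<in>S. (x i)\<^sup>2) ^ m"
proof -
  define u where "u = kernel_iter S B x"
  define y where "y = u 1"
  have u_Suc: "u (Suc t) i = (\<Sum>j\<in>S. B i j * u t j)" for t i by (simp add: u_def)
  have u_pos: "i \<in> S \<Longrightarrow> u t i > 0" for t i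
    by (induction t arbitrary: i) (auto simp: u_def x intro!: sum_pos fin ne mult_pos_pos B)
  have y_pos: "i \<in> S \<Longrightarrow> y i > 0" for i using u_pos by (simp add: y_def)
  have y_eq: "y i = (\<Sum>j\<in>S. B i j * x j)" for i by (simp add: y_def u_def)
  define \<Phi> where "\<Phi> t = (\<Sum>i\<in>S. x i * y i * ln (u t i / x i))" for t
  define Z where "Z = (\<Sum>i\<in>S. x i * y i)"
  define X where "X = (\<Sum>i\<in>S. (x i)\<^sup>2)"
  have Z: "Z > 0" unfolding Z_def by (intro sum_pos fin ne mult_pos_pos x y_pos)
  have X: "X > 0" unfolding X_def by (intro sum_pos fin ne) (use x in force)
  have step: "\<Phi> (Suc t) \<ge> \<Phi> 1 + \<Phi> t" for t
  proof -
    have "\<Phi> 1 + \<Phi> t = (\<Sum>i\<in>S. x i * y i * ln (y i / x i)) +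
        (\<Sum>j\<in>S. \<Sum>i\<in>S. x j * (B j i * x i) * ln (u t j / x j))"
    proof -
      have "\<Phi> t = (\<Sum>j\<in>S. \<Sum>i\<in>S. x j * (B j i * x i) * ln (u t j / x j))"
        by (simp add: \<Phi>_def y_eq sum_distrib_left sum_distrib_right)
      then show ?thesis by (simp add: \<Phi>_def y_def)
    qed
    also have "(\<Sum>j\<in>S. \<Sum>i\<in>S. x j * (B j i * x i) * ln (u t j / x j)) =
        (\<Sum>i\<in>S. \<Sum>j\<in>S. x j * (B j i * x i) * ln (u t j / x j))"
      by (rule sum.swap)
    also have "\<dots> = (\<Sum>i\<in>S. x i * (\<Sum>j\<in>S. (B i j * x j) * ln (u t j / x j)))"
      by (intro sum.cong refl) (simp add: sum_distrib_left, intro sum.cong refl, simp add: sym mult_ac)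
    also have "(\<Sum>i\<in>S. x i * y i * ln (y i / x i)) + \<dots> \<le> \<Phi> (Suc t)"
      unfolding \<Phi>_def sum.distrib[symmetric]
    proof (rule sum_mono)
      fix i assume i: "i \<in> S"
      \<comment> \<open>Jensen along row \<open>i\<close>, whose weights \<open>B i j * x j\<close>
        have total mass \<open>y i\<close>; the factors \<open>x j\<close> cancel inside and leave
        one more application of \<open>B\<close>.\<close>
      have "(\<Sum>j\<in>S. (B i j * x j) * ln (u t j / x j)) \<le>
          y i * ln ((\<Sum>j\<in>S. (B i j * x j) * (u t j / x j)) / y i)"
        unfolding y_eq
        by (rule weighted_sum_ln_le)
          (use i fin ne x B u_pos in \<open>auto intro!: sum_pos less_imp_le[OF mult_pos_pos]\<close>)
      also have "(\<Sum>j\<in>S. (B i j * x j) * (u t j / x j)) = u (Suc t) i"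
        unfolding u_Suc by (intro sum.cong refl) (use x in \<open>force simp: field_simps\<close>)
      finally have "x i * (\<Sum>j\<in>S. (B i j * x j) * ln (u t j / x j)) \<le>
          x i * (y i * ln (u (Suc t) i / y i))"
        using x[OF i] by simp
      moreover have "ln (y i / x i) + ln (u (Suc t) i / y i) = ln (u (Suc t) i / x i)"
        using x[OF i] y_pos[OF i] u_pos[OF i, of "Suc t"] by (simp add: ln_div)
      then have "x i * y i * ln (y i / x i) + x i * (y i * ln (u (Suc t) i / y i)) =
          x i * y i * ln (u (Suc t) i / x i)"
        by (metis distrib_left mult.assoc)
      ultimately show "x i * y i * ln (y i / x i) +
          x i * (\<Sum>j\<in>S. (B i j * x j) * ln (u t j / x j)) \<le>
          x i * y i * ln (u (Suc t) i / x i)"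
        by linarith
    qed
    finally show ?thesis .
  qed
  have "\<Phi> 0 = 0"
    using x by (auto simp: \<Phi>_def u_def intro!: sum.neutral)
  then have \<Phi>_ge: "\<Phi> t \<ge> real t * \<Phi> 1" for t
  proof (induction t)
    case (Suc t)
    then show ?case using step[of t] by (simp add: algebra_simps)
  qed simp
  \<comment> \<open>Jensen for the reciprocal ratios \<open>x i / y i\<close> bounds
    \<open>\<Phi> 1\<close> from below.\<close>
  have "(\<Sum>i\<in>S. x i * y i * ln (x i / y i)) \<le> Z * ln ((\<Sum>i\<in>S. x i * y i * (x i / y i)) / Z)"
    unfolding Z_def
    by (rule weighted_sum_ln_le)
      (use fin x y_pos Z in \<open>auto simp: Z_def intro!: less_imp_le[OF mult_pos_pos]\<close>)
  also have "(\<Sum>i\<in>S. x i * y i * (x i / y i)) = X"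
    unfolding X_def by (intro sum.cong refl) (use y_pos in \<open>force simp: power2_eq_square\<close>)
  also have "(\<Sum>i\<in>S. x i * y i * ln (x i / y i)) = - \<Phi> 1"
    unfolding \<Phi>_def sum_negf[symmetric] y_def[symmetric]
    by (intro sum.cong refl) (use x y_pos in \<open>simp add: ln_div algebra_simps\<close>)
  finally have "\<Phi> 1 \<ge> Z * ln (Z / X)" using X Z by (simp add: ln_div algebra_simps)
  then have 1: "\<Phi> m \<ge> Z * (real m * ln (Z / X))"
    using \<Phi>_ge[of m] mult_left_mono[of "Z * ln (Z / X)" "\<Phi> 1" "real m"]
    by (simp add: algebra_simps)
  define Q where "Q = (\<Sum>i\<in>S. x i * u (Suc m) i)"
  have Q: "Q > 0" unfolding Q_def by (intro sum_pos fin ne mult_pos_pos x u_pos)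
  \<comment> \<open>By symmetry one factor \<open>B\<close> moves onto the left vector. So
    \<open>Q / Z\<close> is the mean of \<open>u m j / x j\<close> under the weights of
    \<open>\<Phi>\<close>, and Jensen bounds \<open>\<Phi> m\<close> from above.\<close>
  have "Q = (\<Sum>i\<in>S. \<Sum>j\<in>S. x i * B i j * u m j)"
    by (simp add: Q_def u_Suc sum_distrib_left mult.assoc)
  also have "\<dots> = (\<Sum>j\<in>S. \<Sum>i\<in>S. x i * B i j * u m j)" by (rule sum.swap)
  also have "\<dots> = (\<Sum>j\<in>S. y j * u m j)"
    by (intro sum.cong refl) (simp add: y_eq sum_distrib_right, intro sum.cong refl, simp add: sym mult_ac)
  also have "\<dots> = (\<Sum>j\<in>S. x j * y j * (u m j / x j))"
    by (intro sum.cong refl) (use x in force)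
  finally have Q_eq: "Q = (\<Sum>j\<in>S. x j * y j * (u m j / x j))" .
  have "\<Phi> m \<le> Z * ln (Q / Z)"
    unfolding \<Phi>_def Q_eq Z_def
    by (rule weighted_sum_ln_le)
      (use fin x y_pos u_pos Z in \<open>auto simp: Z_def intro!: less_imp_le[OF mult_pos_pos]\<close>)
  with 1 have "real m * ln (Z / X) \<le> ln (Q / Z)"
    using Z by (meson mult_le_cancel_left_pos order_trans)
  then have "ln ((Z / X) ^ m) \<le> ln (Q / Z)"
    using X Z by (simp add: ln_realpow)
  then have "(Z / X) ^ m \<le> Q / Z" using X Z Q by simp
  then have "Z ^ Suc m \<le> Q * X ^ m"
    using X Z by (simp add: field_simps power_divide)
  then show ?thesis by (simp add: Z_def Q_def X_def y_def u_def)
qed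

lemma tendsto_kernel_iter:
  assumes "\<And>i j. ((\<lambda>e. B e i j) \<longlongrightarrow> B' i j) F" and "\<And>i. ((\<lambda>e. x e i) \<longlongrightarrow> x' i) F"
  shows "((\<lambda>e. kernel_iter S (B e) (x e) n i) \<longlongrightarrow> kernel_iter S B' x' n i) F"
  by (induction n arbitrary: i) (auto intro!: tendsto_intros assms)

text \<open>The logarithms above force positive entries. Both sides are continuous in
  \<open>x\<close> and \<open>B\<close>, so adding \<open>e\<close> to all entries and letting
  \<open>e\<close> tend to 0 from the right extends the inequality to nonnegative entries.\<close>

theorem Blakley_Roy:
  assumes fin: "finite S"
    and x: "\<And>i. i \<in> S \<Longrightarrow> x i \<ge> 0"
    and B: "\<And>i j. i \<in> S \<Longrightarrow> j \<in> S \<Longrightarrow> B i j \<ge> 0"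
    and sym: "\<And>i j. i \<in> S \<Longrightarrow> j \<in> S \<Longrightarrow> B i j = B j i"
  shows "(\<Sum>i\<in>S. x i * kernel_iter S B x 1 i) ^ Suc m \<le>
    (\<Sum>i\<in>S. x i * kernel_iter S B x (Suc m) i) * (\<Sum>i\<in>S. (x i)\<^sup>2) ^ m"
proof (cases "S = {}")
  case False
  define x' where "x' e i = x i + e" for e i
  define B' where "B' e i j = B i j + e" for e i j
  have x': "((\<lambda>e. x' e i) \<longlongrightarrow> x i) (at_right 0)" for i
    unfolding x'_def by (rule tendsto_eq_intros refl)+ auto
  have B': "((\<lambda>e. B' e i j) \<longlongrightarrow> B i j) (at_right 0)" for i j
    unfolding B'_def by (rule tendsto_eq_intros refl)+ auto
  show ?thesis
  proof (rule tendsto_le[OF trivial_limit_at_right_real])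
    show "((\<lambda>e. (\<Sum>i\<in>S. x' e i * kernel_iter S (B' e) (x' e) (Suc m) i) * (\<Sum>i\<in>S. (x' e i)\<^sup>2) ^ m)
      \<longlongrightarrow> (\<Sum>i\<in>S. x i * kernel_iter S B x (Suc m) i) * (\<Sum>i\<in>S. (x i)\<^sup>2) ^ m) (at_right 0)"
      by (intro tendsto_intros tendsto_kernel_iter x' B')
    show "((\<lambda>e. (\<Sum>i\<in>S. x' e i * kernel_iter S (B' e) (x' e) 1 i) ^ Suc m)
      \<longlongrightarrow> (\<Sum>i\<in>S. x i * kernel_iter S B x 1 i) ^ Suc m) (at_right 0)"
      by (intro tendsto_intros tendsto_kernel_iter x' B')
    show "\<forall>\<^sub>F e in at_right 0. (\<Sum>i\<in>S. x' e i * kernel_iter S (B' e) (x' e) 1 i) ^ Suc m \<le>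
      (\<Sum>i\<in>S. x' e i * kernel_iter S (B' e) (x' e) (Suc m) i) * (\<Sum>i\<in>S. (x' e i)\<^sup>2) ^ m"
      using eventually_at_right_less[of 0]
    proof eventually_elim
      case (elim e)
      show ?case
        by (rule Blakley_Roy_pos[OF fin False])
          (use elim x B sym in \<open>auto simp: x'_def B'_def intro: add_nonneg_pos\<close>)
    qed
  qed
qed simp

section \<open>Powers of kernels on a finite set\<close>

primrec kpow :: "'a set \<Rightarrow> ('a \<Rightarrow> 'a \<Rightarrow> real) \<Rightarrow> nat \<Rightarrow> 'a \<Rightarrow> 'a \<Rightarrow> real" where
  "kpow V K 0 = (\<lambda>x y. if x = y then 1 else 0)"
| "kpow V K (Suc n) = (\<lambda>x y. \<Sum>z\<in>V. K x z * kpow V K n z y)"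

definition ktrace :: "'a set \<Rightarrow> ('a \<Rightarrow> 'a \<Rightarrow> real) \<Rightarrow> nat \<Rightarrow> real" where
  "ktrace V K n = (\<Sum>x\<in>V. kpow V K n x x)"

lemma kpow_add:
  assumes "finite V" "x \<in> V"
  shows "kpow V K (m + n) x y = (\<Sum>z\<in>V. kpow V K m x z * kpow V K n z y)"
  using assms(2)
proof (induction m arbitrary: x)
  case 0
  have "(\<Sum>z\<in>V. kpow V K 0 x z * kpow V K n z y) = (\<Sum>z\<in>V. if x = z then kpow V K n z y else 0)"
    by (intro sum.cong refl) simp
  also have "\<dots> = kpow V K n x y" using 0 assms(1) by simp
  finally show ?case by simp
next
  case (Suc m)
  have "kpow V K (Suc m + n) x y = (\<Sum>w\<in>V. \<Sum>z\<in>V. K x w * (kpow V K m w z * kpow V K n z y))"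
    by (simp add: Suc sum_distrib_left)
  also have "\<dots> = (\<Sum>z\<in>V. \<Sum>w\<in>V. K x w * (kpow V K m w z * kpow V K n z y))"
    by (rule sum.swap)
  finally show ?case by (simp add: sum_distrib_right mult.assoc)
qed

lemma kpow_1: "finite V \<Longrightarrow> y \<in> V \<Longrightarrow> kpow V K (Suc 0) x y = K x y"
proof -
  assume "finite V" "y \<in> V"
  have "kpow V K (Suc 0) x y = (\<Sum>z\<in>V. if z = y then K x z else 0)"
    by (simp, intro sum.cong refl) simp
  also have "\<dots> = K x y" using \<open>finite V\<close> \<open>y \<in> V\<close> by simp
  finally show ?thesis .
qed

lemma kpow_nonneg:
  assumes "\<And>x y. K x y \<ge> 0"
  shows "kpow V K n x y \<ge> 0"
  by (induction n arbitrary: x y) (auto intro!: sum_nonneg mult_nonneg_nonneg assms)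

lemma kpow_mono:
  assumes "\<And>x y. K x y \<ge> 0" and "\<And>x y. K x y \<le> L x y"
  shows "kpow V K n x y \<le> kpow V L n x y"
proof (induction n arbitrary: x y)
  case (Suc n)
  have "0 \<le> L x y" for x y using assms order_trans by blast
  then show ?case
    by (auto intro!: sum_mono mult_mono assms Suc kpow_nonneg)
qed simp

lemma kpow_sym:
  assumes "finite V" and sym: "\<And>x y. K x y = K y x" and "x \<in> V" "y \<in> V"
  shows "kpow V K n x y = kpow V K n y x"
  using assms(3,4)
proof (induction n arbitrary: x y)
  case (Suc n)
  have "kpow V K (Suc n) x y = (\<Sum>z\<in>V. kpow V K n y z * K z x)"
    by (simp, intro sum.cong refl) (use Suc sym in \<open>simp add: mult.commute\<close>)
  also have "\<dots> = (\<Sum>z\<in>V. kpow V K n y z * kpow V K (Suc 0) z x)"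
    by (intro sum.cong refl) (simp only: kpow_1[OF assms(1) Suc.prems(1)])
  also have "\<dots> = kpow V K (n + Suc 0) y x"
    by (rule kpow_add[symmetric]) (use assms Suc in auto)
  finally show ?case by simp
qed auto

lemma ktrace_nonneg: "(\<And>x y. K x y \<ge> 0) \<Longrightarrow> ktrace V K n \<ge> 0"
  unfolding ktrace_def by (intro sum_nonneg kpow_nonneg)

lemma ktrace_mono:
  assumes "\<And>x y. K x y \<ge> 0" and "\<And>x y. K x y \<le> L x y"
  shows "ktrace V K n \<le> ktrace V L n"
  unfolding ktrace_def by (intro sum_mono kpow_mono assms)

lemma ktrace_add:
  assumes "finite V"
  shows "ktrace V K (m + n) = (\<Sum>x\<in>V. \<Sum>y\<in>V. kpow V K m x y * kpow V K n y x)"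
  unfolding ktrace_def by (intro sum.cong refl kpow_add assms)

lemma ktrace_double:
  assumes "finite V" and sym: "\<And>x y. K x y = K y x"
  shows "ktrace V K (2 * m) = (\<Sum>x\<in>V. \<Sum>y\<in>V. (kpow V K m x y)\<^sup>2)"
  unfolding mult_2 ktrace_add[OF assms(1)]
  by (intro sum.cong refl) (metis assms kpow_sym power2_eq_square)

lemma ktrace_2:
  assumes "finite V" and sym: "\<And>x y. K x y = K y x"
  shows "ktrace V K 2 = (\<Sum>x\<in>V. \<Sum>y\<in>V. (K x y)\<^sup>2)"
  using ktrace_double[OF assms, where m = 1] assms(1) by (simp add: kpow_1 del: kpow.simps)

lemma ktrace_scale: "ktrace V (\<lambda>x y. c * K x y) n = c ^ n * ktrace V K n"
proof -
  have "kpow V (\<lambda>x y. c * K x y) n x y = c ^ n * kpow V K n x y" for x y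
    by (induction n arbitrary: x y) (auto simp: sum_distrib_left mult_ac intro!: sum.cong)
  then show ?thesis by (simp add: ktrace_def sum_distrib_left)
qed

section \<open>Inequalities between traces of powers\<close>

lemma double_sum_Cauchy_Schwarz:
  fixes f g :: "'a \<Rightarrow> 'b \<Rightarrow> real"
  shows "(\<Sum>x\<in>A. \<Sum>y\<in>B. f x y * g x y)\<^sup>2 \<le>
    (\<Sum>x\<in>A. \<Sum>y\<in>B. (f x y)\<^sup>2) * (\<Sum>x\<in>A. \<Sum>y\<in>B. (g x y)\<^sup>2)"
  using Cauchy_Schwarz_ineq_sum[of "\<lambda>(x, y). f x y" "\<lambda>(x, y). g x y" "A \<times> B"]
  by (simp add: sum.cartesian_product case_prod_unfold)

text \<open>For symmetric \<open>K\<close> the trace of K^(m+n) is the Frobenius inner product of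
  K^m and K^n. With exponents i and i + 2 this is the log-convexity of the even traces; with l and l
  + 1 it bounds an odd trace by its even neighbours.\<close>

lemma ktrace_Cauchy_Schwarz:
  assumes "finite V" and sym: "\<And>x y. K x y = K y x"
  shows "(ktrace V K (m + n))\<^sup>2 \<le> ktrace V K (2 * m) * ktrace V K (2 * n)"
proof -
  have "ktrace V K (m + n) = (\<Sum>x\<in>V. \<Sum>y\<in>V. kpow V K m x y * kpow V K n x y)"
    unfolding ktrace_add[OF assms(1)]
    by (intro sum.cong refl) (metis assms kpow_sym)
  then show ?thesis
    using double_sum_Cauchy_Schwarz[of "kpow V K m" "kpow V K n" V V]
    by (simp add: ktrace_double[OF assms])
qed

text \<open>Submultiplicativity of the Frobenius norm, whose square at K^m is the trace of
  K^(2m).\<close>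

lemma ktrace_submult:
  assumes "finite V" and sym: "\<And>x y. K x y = K y x"
  shows "ktrace V K (2 * (2 * m)) \<le> (ktrace V K (2 * m))\<^sup>2"
proof -
  have "ktrace V K (2 * (2 * m)) = (\<Sum>x\<in>V. \<Sum>y\<in>V. (kpow V K (m + m) x y)\<^sup>2)"
    by (subst ktrace_double[OF assms]) (simp add: mult_2)
  also have "\<dots> \<le> (\<Sum>x\<in>V. \<Sum>y\<in>V. (\<Sum>z\<in>V. (kpow V K m x z)\<^sup>2) * (\<Sum>z\<in>V. (kpow V K m y z)\<^sup>2))"
  proof (intro sum_mono)
    fix x y assume xy: "x \<in> V" "y \<in> V"
    have "kpow V K (m + m) x y = (\<Sum>z\<in>V. kpow V K m x z * kpow V K m y z)"
      unfolding kpow_add[OF assms(1) xy(1)]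
      by (intro sum.cong refl) (metis assms kpow_sym xy(2))
    then show "(kpow V K (m + m) x y)\<^sup>2 \<le>
        (\<Sum>z\<in>V. (kpow V K m x z)\<^sup>2) * (\<Sum>z\<in>V. (kpow V K m y z)\<^sup>2)"
      using Cauchy_Schwarz_ineq_sum by metis
  qed
  also have "\<dots> = (ktrace V K (2 * m))\<^sup>2"
    by (simp add: ktrace_double[OF assms] power2_eq_square sum_product)
  finally show ?thesis .
qed

text \<open>Log-convexity carries positivity upwards: a vanishing trace at \<open>2 * i\<close>
  would force the one at \<open>2 * (i - 1)\<close> to vanish. The case \<open>i = 1\<close> is the
  hypothesis, so elsewhere \<open>i - 2\<close> is a true difference.\<close>

lemma ktrace_even_pos:
  assumes "finite V" and sym: "\<And>x y. K x y = K y x" and "ktrace V K 2 > 0" and "i \<ge> 1"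
  shows "ktrace V K (2 * i) > 0"
  using assms(4)
proof (induction i rule: less_induct)
  case (less i)
  show ?case
  proof (cases "i = 1")
    case False
    have nn: "ktrace V K (2 * q) \<ge> 0" for q
      by (simp add: ktrace_double[OF assms(1,2)] sum_nonneg)
    have "(ktrace V K (i - 2 + i))\<^sup>2 \<le> ktrace V K (2 * (i - 2)) * ktrace V K (2 * i)"
      by (rule ktrace_Cauchy_Schwarz[OF assms(1,2)])
    moreover have "i - 2 + i = 2 * (i - 1)" using False less by simp
    moreover have "ktrace V K (2 * (i - 1)) > 0" using False less by simp
    ultimately have "ktrace V K (2 * i) \<noteq> 0"
      by (metis mult_zero_right not_less power2_less_0 power_eq_0_iff order_le_less less_numeral_extra(3))
    then show ?thesis using nn[of i] by simp
  qed (use assms in simp)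
qed

text \<open>Blakley--Roy on \<open>V \<times> V\<close> for the identity tensored with
  \<open>K\<close>, applied to K^l read as a vector: its pairing with the n-th iterate is the trace
  of K^(2l+n), and its squared norm is the trace of K^(2l).\<close>

lemma ktrace_odd_ge:
  assumes fin: "finite V" and nn: "\<And>x y. K x y \<ge> 0" and sym: "\<And>x y. K x y = K y x"
  shows "(ktrace V K (2 * l + 1)) ^ Suc m \<le> ktrace V K (2 * l + Suc m) * (ktrace V K (2 * l)) ^ m"
proof -
  define B where "B p q = (if fst p = fst q then K (snd p) (snd q) else 0)" for p q :: "'a \<times> 'a"
  define x where "x p = kpow V K l (snd p) (fst p)" for p :: "'a \<times> 'a"
  have it: "kernel_iter (V \<times> V) B x n p = kpow V K (n + l) (snd p) (fst p)"
    if "p \<in> V \<times> V" for n p using that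
  proof (induction n arbitrary: p)
    case (Suc n)
    have "kernel_iter (V \<times> V) B x (Suc n) p =
        (\<Sum>q\<in>V \<times> V. B p q * kpow V K (n + l) (snd q) (fst q))"
      using Suc.IH by (auto intro!: sum.cong)
    also have "\<dots> = (\<Sum>v\<in>V. \<Sum>b\<in>V. B p (v, b) * kpow V K (n + l) b v)"
      by (simp add: sum.cartesian_product case_prod_unfold)
    also have "\<dots> = (\<Sum>v\<in>V. if fst p = v then \<Sum>b\<in>V. K (snd p) b * kpow V K (n + l) b v else 0)"
      by (intro sum.cong refl) (simp add: B_def)
    also have "\<dots> = kpow V K (Suc n + l) (snd p) (fst p)"
      using fin Suc.prems by (auto simp: mem_Times_iff)
    finally show ?case .
  qed (simp add: x_def)
  have tr: "(\<Sum>p\<in>V \<times> V. x p * kernel_iter (V \<times> V) B x n p) = ktrace V K (2 * l + n)" for n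
  proof -
    have "(\<Sum>p\<in>V \<times> V. x p * kernel_iter (V \<times> V) B x n p) =
        (\<Sum>p\<in>V \<times> V. kpow V K l (fst p) (snd p) * kpow V K (n + l) (snd p) (fst p))"
      by (intro sum.cong refl) (auto simp: it x_def kpow_sym[OF fin sym])
    also have "\<dots> = ktrace V K (l + (n + l))"
      unfolding ktrace_add[OF fin] by (simp add: sum.cartesian_product case_prod_unfold)
    finally show ?thesis by (simp add: mult_2 add_ac)
  qed
  have "(\<Sum>p\<in>V \<times> V. (x p)\<^sup>2) = ktrace V K (2 * l)"
    using tr[of 0] by (simp add: power2_eq_square)
  moreover have "(\<Sum>p\<in>V \<times> V. x p * kernel_iter (V \<times> V) B x 1 p) ^ Suc m \<le>
      (\<Sum>p\<in>V \<times> V. x p * kernel_iter (V \<times> V) B x (Suc m) p) * (\<Sum>p\<in>V \<times> V. (x p)\<^sup>2) ^ m"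
    by (rule Blakley_Roy) (auto simp: fin B_def x_def nn intro: sym kpow_nonneg)
  ultimately show ?thesis unfolding tr by simp
qed

text \<open>Blakley--Roy with the constant vector bounds the sum of all entries of K^j from below;
  Cauchy--Schwarz against the constant 1 turns that sum into the Frobenius norm of K^j.\<close>

lemma ktrace_even_ge_mean:
  assumes fin: "finite V" "V \<noteq> {}" and nn: "\<And>x y. K x y \<ge> 0" and sym: "\<And>x y. K x y = K y x"
    and "j \<ge> 1"
  shows "ktrace V K (2 * j) \<ge> ((\<Sum>x\<in>V. \<Sum>y\<in>V. K x y) / card V) ^ (2 * j)"
proof -
  obtain m where m: "j = Suc m" using \<open>j \<ge> 1\<close> by (cases j) auto
  define n where "n = real (card V)"
  have n: "n > 0" using fin by (simp add: n_def card_gt_0_iff)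
  have it: "kernel_iter V K (\<lambda>_. 1) q x = (\<Sum>y\<in>V. kpow V K q x y)" if "x \<in> V" for q x
    using that
  proof (induction q arbitrary: x)
    case (Suc q)
    have "kernel_iter V K (\<lambda>_. 1) (Suc q) x = (\<Sum>z\<in>V. \<Sum>y\<in>V. K x z * kpow V K q z y)"
      by (simp add: Suc sum_distrib_left)
    also have "\<dots> = (\<Sum>y\<in>V. \<Sum>z\<in>V. K x z * kpow V K q z y)" by (rule sum.swap)
    finally show ?case by simp
  qed (use fin in simp)
  define s where "s q = (\<Sum>x\<in>V. \<Sum>y\<in>V. kpow V K q x y)" for q
  define S where "S = (\<Sum>x\<in>V. \<Sum>y\<in>V. K x y)"
  have s1: "s (Suc 0) = S" unfolding s_def S_def using kpow_1[OF fin(1)] by simp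
  have S: "S \<ge> 0" unfolding S_def by (intro sum_nonneg nn)
  have s: "(\<Sum>x\<in>V. 1 * kernel_iter V K (\<lambda>_. 1) q x) = s q" for q
    unfolding s_def by (intro sum.cong refl) (simp add: it)
  have "(\<Sum>x\<in>V. 1 * kernel_iter V K (\<lambda>_. 1) 1 x) ^ Suc m \<le>
      (\<Sum>x\<in>V. 1 * kernel_iter V K (\<lambda>_. 1) (Suc m) x) * (\<Sum>x\<in>V. 1\<^sup>2) ^ m"
    by (rule Blakley_Roy) (auto simp: fin nn intro: sym)
  then have "s 1 ^ Suc m \<le> s (Suc m) * n ^ m"
    unfolding s by (simp add: n_def)
  then have "S ^ j / n ^ m \<le> s j" using n s1 by (simp add: m field_simps)
  then have "(S ^ j / n ^ m)\<^sup>2 \<le> (s j)\<^sup>2" using S n by (intro power_mono) auto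
  also have "(s j)\<^sup>2 \<le> n\<^sup>2 * ktrace V K (2 * j)"
    using double_sum_Cauchy_Schwarz[of "\<lambda>_ _. 1" "kpow V K j" V V]
    by (simp add: s_def ktrace_double[OF fin(1) sym] n_def power2_eq_square)
  finally have "(S ^ j / n ^ m)\<^sup>2 / n\<^sup>2 \<le> ktrace V K (2 * j)"
    using n by (simp add: field_simps)
  also have "(S ^ j / n ^ m)\<^sup>2 / n\<^sup>2 = (S / n) ^ (2 * j)"
    using n by (simp add: m power_divide power_mult[symmetric] power_mult_distrib mult.commute
        flip: power_add power_Suc)
  finally show ?thesis by (simp add: S_def n_def)
qed

text \<open>Telescoping over the hybrid traces \<open>h i\<close> of L^i K^(m+1-i). Exchanging one
  \<open>K\<close> for \<open>L\<close> costs at most \<open>D\<close>, once the other factors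
  \<open>L\<close> are enlarged to \<open>K\<close> and the product is rotated cyclically.\<close>

lemma ktrace_diff_le:
  assumes fin: "finite V" and L: "\<And>x y. L x y \<ge> 0" and LK: "\<And>x y. L x y \<le> K x y"
  shows "ktrace V K (Suc m) - ktrace V L (Suc m) \<le>
    Suc m * (\<Sum>x\<in>V. \<Sum>y\<in>V. (K x y - L x y) * kpow V K m y x)"
proof -
  have K: "K x y \<ge> 0" for x y using L LK order_trans by blast
  define D where "D = (\<Sum>x\<in>V. \<Sum>y\<in>V. (K x y - L x y) * kpow V K m y x)"
  define h where "h i = (\<Sum>x\<in>V. \<Sum>y\<in>V. kpow V L i x y * kpow V K (Suc m - i) y x)" for i
  have step: "h i \<le> h (Suc i) + D" if im: "i \<le> m" for i
  proof -
    obtain q where q: "m = i + q" using im le_Suc_ex by blast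
    have 1: "h i = (\<Sum>x\<in>V. \<Sum>y\<in>V. \<Sum>z\<in>V. kpow V L i x y * (K y z * kpow V K q z x))"
      by (simp add: h_def q sum_distrib_left)
    have "h (Suc i) = (\<Sum>x\<in>V. \<Sum>z\<in>V. (\<Sum>y\<in>V. kpow V L i x y * L y z) * kpow V K q z x)"
    proof -
      have "kpow V L (Suc i) x z = (\<Sum>y\<in>V. kpow V L i x y * L y z)" if "x \<in> V" "z \<in> V" for x z
        using kpow_add[OF fin that(1), of L i "Suc 0" z] kpow_1[OF fin that(2)]
        by (simp del: kpow.simps)
      then show ?thesis by (simp add: h_def q del: kpow.simps)
    qed
    also have "\<dots> = (\<Sum>x\<in>V. \<Sum>z\<in>V. \<Sum>y\<in>V. kpow V L i x y * (L y z * kpow V K q z x))"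
      by (simp add: sum_distrib_right mult.assoc)
    also have "\<dots> = (\<Sum>x\<in>V. \<Sum>y\<in>V. \<Sum>z\<in>V. kpow V L i x y * (L y z * kpow V K q z x))"
      by (intro sum.cong refl sum.swap)
    finally have "h i - h (Suc i) =
        (\<Sum>x\<in>V. \<Sum>y\<in>V. \<Sum>z\<in>V. kpow V L i x y * ((K y z - L y z) * kpow V K q z x))"
      unfolding 1 by (simp add: sum_subtractf algebra_simps)
    also have "\<dots> \<le> (\<Sum>x\<in>V. \<Sum>y\<in>V. \<Sum>z\<in>V. kpow V K i x y * ((K y z - L y z) * kpow V K q z x))"
      by (intro sum_mono mult_right_mono mult_nonneg_nonneg kpow_mono kpow_nonneg K L LK) (simp add: LK)
    also have "\<dots> = (\<Sum>y\<in>V. \<Sum>x\<in>V. \<Sum>z\<in>V. kpow V K i x y * ((K y z - L y z) * kpow V K q z x))"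
      by (rule sum.swap)
    also have "\<dots> = (\<Sum>y\<in>V. \<Sum>z\<in>V. \<Sum>x\<in>V. kpow V K i x y * ((K y z - L y z) * kpow V K q z x))"
      by (intro sum.cong refl sum.swap)
    also have "\<dots> = (\<Sum>y\<in>V. \<Sum>z\<in>V. (K y z - L y z) * (\<Sum>x\<in>V. kpow V K q z x * kpow V K i x y))"
      by (simp add: sum_distrib_left mult_ac)
    also have "\<dots> = D"
      unfolding D_def
      by (intro sum.cong refl) (simp add: q kpow_add[OF fin, symmetric] add.commute)
    finally show ?thesis by simp
  qed
  have "h 0 \<le> h i + real i * D" if "i \<le> Suc m" for i using that
  proof (induction i)
    case (Suc i)
    then show ?case using step[of i] by (simp add: algebra_simps)
  qed simp
  from this[of "Suc m"] have "h 0 \<le> h (Suc m) + real (Suc m) * D" by simp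
  moreover have "h 0 = ktrace V K (Suc m)"
  proof -
    have "(\<Sum>y\<in>V. kpow V L 0 x y * kpow V K (Suc m) y x) = kpow V K (Suc m) x x" if "x \<in> V" for x
      using that kpow_add[OF fin that, of K 0 "Suc m" x] by (simp del: kpow.simps(2))
    then show ?thesis by (simp add: h_def ktrace_def del: kpow.simps)
  qed
  moreover have "h (Suc m) = ktrace V L (Suc m)"
  proof -
    have "(\<Sum>y\<in>V. kpow V L (Suc m) x y * kpow V K 0 y x) = kpow V L (Suc m) x x" if "x \<in> V" for x
      using that kpow_add[OF fin that, of L "Suc m" 0 x] by (simp del: kpow.simps(2))
    then show ?thesis by (simp add: h_def ktrace_def del: kpow.simps)
  qed
  ultimately show ?thesis by (simp add: D_def)
qed

section \<open>Regularised kernels\<close>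

text \<open>The increments are nondecreasing from index 1 on, so the increment at \<open>i\<close>
  bounds all later ones from below and all earlier ones from above.\<close>

lemma convex_seq_slope:
  fixes f :: "nat \<Rightarrow> real"
  assumes conv: "\<And>i. i \<ge> 1 \<Longrightarrow> f (Suc i) - f i \<le> f (Suc (Suc i)) - f (Suc i)" and "i \<ge> 1"
  shows "real d * (f (Suc i) - f i) \<le> f (i + d) - f i"
    and "f i - f 1 \<le> (real i - 1) * (f (Suc i) - f i)"
proof -
  have slope: "f (Suc i) - f i \<le> f (Suc (i + d)) - f (i + d)" for d
  proof (induction d)
    case (Suc d)
    then show ?case using conv[of "i + d"] \<open>i \<ge> 1\<close> by simp
  qed simp
  show "real d * (f (Suc i) - f i) \<le> f (i + d) - f i"
  proof (induction d)
    case (Suc d)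
    then show ?case using slope[of d] by (simp add: algebra_simps)
  qed simp
  show "f i - f 1 \<le> (real i - 1) * (f (Suc i) - f i)"
    using \<open>i \<ge> 1\<close>
  proof (induction i rule: dec_induct)
    case (step i)
    have "real i * (f (Suc i) - f i) \<le> real i * (f (Suc (Suc i)) - f (Suc i))"
      using conv[of i] step by (intro mult_left_mono) auto
    with step show ?case by (simp add: algebra_simps)
  qed simp
qed

text \<open>With j = k - l + 1 and M = 2k - 2l + 1 the branches are 1 + (2j - 1)/(2l + 1) and (2kM -
  1)/(2lM - 1), the forms in which the logarithmic estimates produce them.\<close>

definition cycle_exponent :: "nat \<Rightarrow> nat \<Rightarrow> real" where
  "cycle_exponent k l = (if k \<le> 2 * l - 1
     then 2 * (real k + 1) / (2 * real l + 1)
     else (2 * real k * (2 * real k - 2 * real l + 1) - 1) /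
          (2 * real l * (2 * real k - 2 * real l + 1) - 1))"

text \<open>Here \<open>f i\<close> and \<open>c\<close> stand for the logarithms of the densities
  of C_{2i} and C_{2l+1}. Convexity and \<open>dbl\<close> make \<open>f i / i\<close>
  nonincreasing, which is the monotonicity of Schatten norms. Hence c/(2l + 1), through
  \<open>odd\<close>, and f 1, through \<open>mean\<close>, are both at most f j/(2j).\<close>

lemma log_combination_small:
  fixes f :: "nat \<Rightarrow> real"
  assumes "1 \<le> j" "j \<le> l"
    and conv: "\<And>i. i \<ge> 1 \<Longrightarrow> f (Suc i) - f i \<le> f (Suc (Suc i)) - f (Suc i)"
    and dbl: "\<And>i. i \<ge> 1 \<Longrightarrow> f (2 * i) \<le> 2 * f i"
    and odd: "2 * c \<le> f l + f (Suc l)"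
    and mean: "f j \<ge> 2 * real j * f 1"
  shows "f j - f 1 \<ge> (2 * real j - 1) / (2 * real l + 1) * c"
proof -
  have dec: "f (Suc i) / real (Suc i) \<le> f i / real i" if "i \<ge> 1" for i
  proof -
    have "real i * (f (Suc i) - f i) \<le> f i"
      using convex_seq_slope(1)[where f = f, OF conv that, where d = i] dbl[OF that]
      by (simp flip: mult_2)
    then show ?thesis using that by (simp add: field_simps)
  qed
  have "f l / real l \<le> f j / real j"
    using \<open>j \<le> l\<close>
  proof (induction l rule: dec_induct)
    case (step i)
    then show ?case using dec[of i] \<open>1 \<le> j\<close> by linarith
  qed simp
  moreover have "2 * c \<le> (2 * real l + 1) * (f l / real l)"
  proof -
    define h where "h = f l / real l"
    have "f (Suc l) \<le> (real l + 1) * h"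
      using dec[of l] assms(1,2) by (simp add: h_def field_simps)
    moreover have "f l = real l * h" using assms(1,2) by (simp add: h_def)
    ultimately show ?thesis using odd unfolding h_def[symmetric] by (simp add: algebra_simps)
  qed
  ultimately have "2 * c \<le> (2 * real l + 1) * (f j / real j)"
    by (meson mult_left_mono of_nat_0_le_iff order_trans add_nonneg_nonneg mult_nonneg_nonneg
        zero_le_numeral zero_le_one)
  then have "c / (2 * real l + 1) \<le> f j / (2 * real j)"
    using \<open>1 \<le> j\<close> by (simp add: field_simps)
  then have "(2 * real j - 1) * (c / (2 * real l + 1)) \<le> (2 * real j - 1) * (f j / (2 * real j))"
    using \<open>1 \<le> j\<close> by (intro mult_left_mono) auto
  also have "\<dots> = f j - f j / (2 * real j)"
    using \<open>1 \<le> j\<close> by (simp add: field_simps)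
  also have "\<dots> \<le> f j - f 1"
    using mean \<open>1 \<le> j\<close> by (simp add: field_simps)
  finally show ?thesis by simp
qed

text \<open>
  Here \<open>x, c, a, g, q\<close> stand for the logarithms of the densities of \<open>C\<^bsub>2k+1\<^esub>\<close>, \<open>C\<^bsub>2l+1\<^esub>\<close>, \<open>C\<^bsub>2l\<^esub>\<close>,
  \<open>C\<^bsub>2j\<^esub>\<close> with \<open>j = k - l + 1\<close>, and of an edge; \<open>M = 2 k - 2 l + 1\<close>.
  The assumptions I, II with E, and II with mean are weighted by \<open>M\<close>, \<open>(2 l - 2) M\<close> and \<open>M - 1\<close>,
  so that \<open>a\<close> and \<open>q\<close> cancel.
\<close>

lemma log_combination_large:
  fixes x c a g q \<sigma> k l :: real
  defines "M \<equiv> 2 * k - 2 * l + 1"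
  assumes "l \<ge> 1" "k > l" "\<sigma> \<le> 0"
    and I: "M * c \<le> x + (M - 1) * a"
    and II: "\<sigma> + c + g - q \<le> x"
    and E: "(k - l) * (a - q) \<le> (l - 1) * (g - q)"
    and mean: "g \<ge> (M + 1) * q"
  shows "\<sigma> + (2 * k * M - 1) / (2 * l * M - 1) * c \<le> x"
proof -
  have M: "M > 1" using assms by (simp add: M_def)
  then have D: "2 * l * M - 1 > 0"
    using mult_mono[of 1 l 1 M] \<open>l \<ge> 1\<close> by simp
  have 1: "M * (M * c) \<le> M * (x + (M - 1) * a)"
    using I M by (intro mult_left_mono) auto
  have 2: "(2 * l - 2) * M * (\<sigma> + c) + M * ((M - 1) * (a - q)) \<le> (2 * l - 2) * M * x"
  proof -
    have "(2 * l - 2) * M * (\<sigma> + c + g - q) \<le> (2 * l - 2) * M * x"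
      using II M \<open>l \<ge> 1\<close> by (intro mult_left_mono) auto
    moreover have "2 * M * ((k - l) * (a - q)) \<le> 2 * M * ((l - 1) * (g - q))"
      using E M by (intro mult_left_mono) auto
    moreover have "2 * M * ((k - l) * (a - q)) = M * ((M - 1) * (a - q))"
      by (simp add: M_def algebra_simps)
    ultimately show ?thesis by (simp add: algebra_simps)
  qed
  have 3: "(M - 1) * (\<sigma> + c + M * q) \<le> (M - 1) * x"
    using II mean M by (intro mult_left_mono) (auto simp: algebra_simps)
  \<comment> \<open>The weights of \<open>x\<close> add up to 2lM - 1, and those of \<open>c\<close>
    to M^2 + (2l - 1)M - 1 = 2kM - 1 because M + 2l - 1 = 2k.\<close>
  have "(2 * k * M - 1) * c + ((2 * l - 2) * M + (M - 1)) * \<sigma> \<le> (2 * l * M - 1) * x"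
    using 1 2 3 by (simp add: M_def algebra_simps)
  \<comment> \<open>\<open>I\<close> carries no \<open>\<sigma>\<close>, so its weight
    \<open>M\<close> is missing from that of \<open>\<sigma>\<close>; adding it is harmless since
    \<open>\<sigma> \<le> 0\<close>.\<close>
  moreover have "(2 * l * M - 1) * \<sigma> \<le> ((2 * l - 2) * M + (M - 1)) * \<sigma>"
    using M \<open>\<sigma> \<le> 0\<close> by (intro mult_right_mono_neg) (auto simp: algebra_simps)
  ultimately have "(2 * k * M - 1) * c + (2 * l * M - 1) * \<sigma> \<le> (2 * l * M - 1) * x"
    by linarith
  then show ?thesis using D by (simp add: field_simps)
qed

text \<open>The average of W^(2l) over the arcs is the trace at \<open>2 * l + 1\<close> divided by
  the sum of \<open>W\<close>; \<open>reg\<close> asks for the fraction \<open>s\<close> of this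
  average at every arc. The only price in the conclusion is \<open>ln s\<close>.\<close>

lemma regular_kernel_bound:
  assumes fin: "finite V" "V \<noteq> {}"
    and val: "\<And>x y. W x y \<in> {0, 1 / real (card V)}" and sym: "\<And>x y. W x y = W y x"
    and kl: "k > l" "l \<ge> 1" and s: "0 < s" "s \<le> 1"
    and C: "ktrace V W (2 * l + 1) > 0"
    and reg: "\<And>x y. x \<in> V \<Longrightarrow> y \<in> V \<Longrightarrow> W x y \<noteq> 0 \<Longrightarrow>
      s * ktrace V W (2 * l + 1) \<le> kpow V W (2 * l) x y * (\<Sum>x\<in>V. \<Sum>y\<in>V. W x y)"
  shows "0 < ktrace V W (2 * k + 1)"
    and "ln s + cycle_exponent k l * ln (ktrace V W (2 * l + 1)) \<le> ln (ktrace V W (2 * k + 1))"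
proof -
  define n where "n = real (card V)"
  have n: "n > 0" using fin by (simp add: n_def card_gt_0_iff)
  define t where "t = ktrace V W"
  define S where "S = (\<Sum>x\<in>V. \<Sum>y\<in>V. W x y)"
  define j where "j = k - l + 1"
  have j: "j \<ge> 1" by (simp add: j_def)
  have W0: "W x y \<ge> 0" for x y using val[of x y] by auto
  \<comment> \<open>Squaring an entry of \<open>W\<close> amounts to dividing it by
    \<open>n\<close>, so \<open>t 2\<close> is the edge density.\<close>
  have t2: "t 2 = S / n"
    unfolding t_def S_def ktrace_2[where K = W, OF fin(1) sym] sum_divide_distrib
  proof (intro sum.cong refl)
    fix x y
    show "(W x y)\<^sup>2 = W x y / n" using val[of x y] by (auto simp: n_def power2_eq_square)
  qed
  have C0: "t (2 * l + 1) > 0" using C by (simp add: t_def)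
  have "t 2 \<ge> 0" unfolding t_def by (rule ktrace_nonneg[OF W0])
  moreover have "t 2 \<noteq> 0"
    using ktrace_Cauchy_Schwarz[where K = W, OF fin(1) sym, where m = "2 * l" and n = 1] C0 by (auto simp: t_def)
  ultimately have p: "t 2 > 0" by simp
  have ev: "t (2 * i) > 0" if "i \<ge> 1" for i
    using ktrace_even_pos[where K = W, OF fin(1) sym _ that] p by (simp add: t_def)
  have S: "S > 0" using p n by (simp add: t2 zero_less_divide_iff)
  \<comment> \<open>Gluing along an edge: W^(2l) dominates r n W entrywise, and both are paired with
    W^(2j-1). One side closes up to C_{2j}, the other to C_{2k+1}, as 2l + 2j - 1 = 2k + 1.\<close>
  have II: "s * t (2 * l + 1) * t (2 * j) / t 2 \<le> t (2 * k + 1)"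
  proof -
    define r where "r = s * t (2 * l + 1) / S"
    have "r * n * t (2 * j) = (\<Sum>x\<in>V. \<Sum>y\<in>V. r * n * (W x y * kpow V W (2 * j - 1) y x))"
    proof -
      have "2 * j = Suc 0 + (2 * j - 1)" using j by simp
      then have "t (2 * j) = (\<Sum>x\<in>V. \<Sum>y\<in>V. kpow V W (Suc 0) x y * kpow V W (2 * j - 1) y x)"
        unfolding t_def using ktrace_add[OF fin(1)] by metis
      also have "\<dots> = (\<Sum>x\<in>V. \<Sum>y\<in>V. W x y * kpow V W (2 * j - 1) y x)"
        by (intro sum.cong refl arg_cong2[where f = "(*)"] kpow_1 fin)
      finally show ?thesis by (simp add: sum_distrib_left)
    qed
    also have "\<dots> \<le> (\<Sum>x\<in>V. \<Sum>y\<in>V. kpow V W (2 * l) x y * kpow V W (2 * j - 1) y x)"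
    proof (intro sum_mono)
      fix x y assume xy: "x \<in> V" "y \<in> V"
      show "r * n * (W x y * kpow V W (2 * j - 1) y x) \<le>
          kpow V W (2 * l) x y * kpow V W (2 * j - 1) y x"
      proof (cases "W x y = 0")
        case True
        then show ?thesis by (simp add: kpow_nonneg[OF W0])
      next
        case False
        then have "W x y = 1 / n" using val[of x y] by (auto simp: n_def)
        moreover have "r \<le> kpow V W (2 * l) x y"
          using reg[OF xy False] S by (simp add: r_def t_def S_def field_simps)
        ultimately show ?thesis
          using n by (simp add: mult_right_mono kpow_nonneg[OF W0])
      qed
    qed
    also have "\<dots> = t (2 * l + (2 * j - 1))"
      unfolding t_def by (rule ktrace_add[OF fin(1), symmetric])
    also have "2 * l + (2 * j - 1) = 2 * k + 1" using kl by (simp add: j_def)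
    finally show ?thesis using n by (simp add: r_def t2 field_simps)
  qed
  moreover have "s * t (2 * l + 1) * t (2 * j) / t 2 > 0"
    using s C0 ev[OF j] p by simp
  ultimately have X: "t (2 * k + 1) > 0" by linarith
  then show "0 < ktrace V W (2 * k + 1)" by (simp add: t_def)
  define f where "f i = ln (t (2 * i))" for i
  define c where "c = ln (t (2 * l + 1))"
  define x where "x = ln (t (2 * k + 1))"
  have "ln (s * t (2 * l + 1) * t (2 * j) / t 2) \<le> x"
    unfolding x_def using II X s C0 ev[OF j] p by (subst ln_le_cancel_iff) auto
  then have II': "ln s + c + f j - f 1 \<le> x"
    using s C0 ev[OF j] p by (simp add: c_def f_def ln_div ln_mult)
  have mean: "f j \<ge> 2 * real j * f 1"
  proof -
    have "(t 2) ^ (2 * j) \<le> t (2 * j)"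
      using ktrace_even_ge_mean[where K = W, OF fin W0 sym j]
      unfolding t2 S_def n_def by (simp add: t_def)
    then have "ln ((t 2) ^ (2 * j)) \<le> f j"
      unfolding f_def using p ev[OF j] by simp
    then show ?thesis using p by (simp add: f_def ln_realpow)
  qed
  have conv: "f (Suc i) - f i \<le> f (Suc (Suc i)) - f (Suc i)" if "i \<ge> 1" for i
  proof -
    have "(t (2 * Suc i))\<^sup>2 \<le> t (2 * i) * t (2 * Suc (Suc i))"
    proof -
      have "i + Suc (Suc i) = 2 * Suc i" by simp
      then show ?thesis
        unfolding t_def using ktrace_Cauchy_Schwarz[where K = W, OF fin(1) sym] by metis
    qed
    then have "ln ((t (2 * Suc i))\<^sup>2) \<le> ln (t (2 * i) * t (2 * Suc (Suc i)))"
      using ev[OF that] ev[of "Suc i"] ev[of "Suc (Suc i)"] by (subst ln_le_cancel_iff) auto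
    then show ?thesis
      using ev[OF that] ev[of "Suc i"] ev[of "Suc (Suc i)"]
      by (simp add: f_def ln_mult ln_realpow del: mult_Suc_right)
  qed
  have dbl: "f (2 * i) \<le> 2 * f i" if "i \<ge> 1" for i
  proof -
    have "ln (t (2 * (2 * i))) \<le> ln ((t (2 * i))\<^sup>2)"
      using ktrace_submult[where K = W, OF fin(1) sym, where m = i] ev[OF that] ev[of "2 * i"] that
      by (subst ln_le_cancel_iff) (auto simp: t_def)
    then show ?thesis using ev[OF that] by (simp add: f_def ln_realpow)
  qed
  have odd: "2 * c \<le> f l + f (Suc l)"
  proof -
    have "(t (2 * l + 1))\<^sup>2 \<le> t (2 * l) * t (2 * Suc l)"
    proof -
      have "l + Suc l = 2 * l + 1" by simp
      then show ?thesis
        unfolding t_def using ktrace_Cauchy_Schwarz[where K = W, OF fin(1) sym] by metis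
    qed
    then have "ln ((t (2 * l + 1))\<^sup>2) \<le> ln (t (2 * l) * t (2 * Suc l))"
      using ev[of l] ev[of "Suc l"] C0 kl by (subst ln_le_cancel_iff) auto
    then show ?thesis
      using ev[of l] ev[of "Suc l"] C0 kl
      by (simp add: f_def c_def ln_mult ln_realpow del: mult_Suc_right)
  qed
  have "ln s + cycle_exponent k l * c \<le> x"
  proof (cases "k \<le> 2 * l - 1")
    case True
    \<comment> \<open>The case condition says exactly that C_{2j} is no longer than C_{2l}.\<close>
    then have "j \<le> l" using kl by (simp add: j_def)
    then have "f j - f 1 \<ge> (2 * real j - 1) / (2 * real l + 1) * c"
      using log_combination_small[where f = f, OF j _ conv dbl odd mean] by blast
    moreover have "cycle_exponent k l * c = c + (2 * real j - 1) / (2 * real l + 1) * c"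
      using True kl by (simp add: cycle_exponent_def j_def of_nat_diff field_simps)
    ultimately show ?thesis using II' by linarith
  next
    case False
    define M where "M = 2 * real k - 2 * real l + 1"
    have Mj: "M + 1 = 2 * real j" using kl by (simp add: M_def j_def of_nat_diff)
    have I: "M * c \<le> x + (M - 1) * f l"
    proof -
      define m where "m = 2 * (k - l)"
      have m: "real m = M - 1" using kl by (simp add: m_def M_def of_nat_diff)
      have "t (2 * l + 1) ^ Suc m \<le> t (2 * l + Suc m) * t (2 * l) ^ m"
        unfolding t_def by (rule ktrace_odd_ge[where K = W, OF fin(1) W0 sym])
      also have "2 * l + Suc m = 2 * k + 1" using kl by (simp add: m_def)
      finally have "ln (t (2 * l + 1) ^ Suc m) \<le> ln (t (2 * k + 1) * t (2 * l) ^ m)"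
        using ev[of l] kl X C0 by (subst ln_le_cancel_iff) auto
      then have "real (Suc m) * c \<le> x + real m * f l"
        using ev[of l] kl X C0 by (simp add: ln_mult ln_realpow c_def x_def f_def del: power_Suc)
      then show ?thesis using m by simp
    qed
    \<comment> \<open>Since k - l = j - 1, this compares chord slopes of the convex sequence
      \<open>f\<close>, cleared of denominators: from 1 to \<open>l\<close> against from 1 to
      \<open>j\<close>.\<close>
    have E: "(real k - real l) * (f l - f 1) \<le> (real l - 1) * (f j - f 1)"
    proof -
      have "j \<ge> l" using False kl by (simp add: j_def)
      then obtain d where d: "j = l + d" using le_Suc_ex by blast
      have "(real l - 1) * (real d * (f (Suc l) - f l)) \<le> (real l - 1) * (f j - f l)"
        using convex_seq_slope(1)[where f = f and i = l and d = d, OF conv] kl d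
        by (intro mult_left_mono) auto
      moreover have "real d * (f l - f 1) \<le> real d * ((real l - 1) * (f (Suc l) - f l))"
        using convex_seq_slope(2)[where f = f and i = l, OF conv] kl
        by (intro mult_left_mono) auto
      moreover have "real k - real l = real l - 1 + real d"
        using d kl by (simp add: j_def of_nat_diff)
      ultimately show ?thesis by (simp only:) (simp add: algebra_simps)
    qed
    have "ln s + (2 * real k * M - 1) / (2 * real l * M - 1) * c \<le> x"
      unfolding M_def
      by (rule log_combination_large[where a = "f l" and g = "f j" and q = "f 1"])
        (use kl s I II' E mean Mj in \<open>auto simp: M_def[symmetric]\<close>)
    then show ?thesis using False by (simp add: cycle_exponent_def M_def)
  qed
  then show "ln s + cycle_exponent k l * ln (ktrace V W (2 * l + 1)) \<le> ln (ktrace V W (2 * k + 1))"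
    by (simp add: c_def x_def t_def)
qed

section \<open>Regularisation by deleting arcs\<close>

text \<open>The adjacency matrix scaled by the number of vertices of \<open>V\<close>, also when
  arcs are deleted: traces then remain densities, of a spanning subgraph.\<close>

definition arc_kernel :: "'a set \<Rightarrow> ('a \<times> 'a) set \<Rightarrow> 'a \<Rightarrow> 'a \<Rightarrow> real" where
  "arc_kernel V F x y = (if (x, y) \<in> F then 1 / real (card V) else 0)"

lemma arc_kernel_nonneg: "arc_kernel V F x y \<ge> 0"
  by (simp add: arc_kernel_def)

lemma arc_kernel_mono: "G \<subseteq> F \<Longrightarrow> arc_kernel V G x y \<le> arc_kernel V F x y"
  by (auto simp: arc_kernel_def)

lemma arc_kernel_sym: "sym F \<Longrightarrow> arc_kernel V F x y = arc_kernel V F y x"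
  by (auto simp: arc_kernel_def dest: symD)

lemma sum_arcs:
  assumes "finite V" "F \<subseteq> V \<times> V"
  shows "(\<Sum>x\<in>V. \<Sum>y\<in>V. if (x, y) \<in> F then g x y else 0) = (\<Sum>(x, y)\<in>F. g x y :: real)"
proof -
  have "(\<Sum>x\<in>V. \<Sum>y\<in>V. if (x, y) \<in> F then g x y else 0) =
      (\<Sum>p\<in>V \<times> V. if p \<in> F then (case p of (x, y) \<Rightarrow> g x y) else 0)"
    by (simp add: sum.cartesian_product case_prod_unfold cong: if_cong)
  also have "\<dots> = (\<Sum>p\<in>(V \<times> V) \<inter> F. case p of (x, y) \<Rightarrow> g x y)"
    by (rule sum.inter_restrict[symmetric]) (use assms in auto)
  also have "(V \<times> V) \<inter> F = F" using assms by auto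
  finally show ?thesis .
qed

lemma ktrace_empty: "ktrace V (arc_kernel V {}) (Suc m) = 0"
  by (simp add: ktrace_def arc_kernel_def)

text \<open>
  Among the symmetric subsets \<open>G\<close> of \<open>F\<close> take one that maximises \<open>t\<^sup>N / |G|\<close>, with \<open>t\<close> the trace;
  deleting any edge of \<open>G\<close> must then lower the trace considerably.
\<close>

lemma regular_subgraph:
  assumes fin: "finite V" and F: "F \<subseteq> V \<times> V" "sym F" and "N \<ge> 1"
    and pos: "ktrace V (arc_kernel V F) (Suc m) > 0"
  obtains G where "G \<subseteq> F" "sym G" "ktrace V (arc_kernel V G) (Suc m) > 0"
    and "ktrace V (arc_kernel V F) (Suc m) ^ N \<le> ktrace V (arc_kernel V G) (Suc m) ^ N * card F"
    and "\<And>x y. (x, y) \<in> G \<Longrightarrow> ktrace V (arc_kernel V G) (Suc m) \<le>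
      real (N * Suc m) * (kpow V (arc_kernel V G) m x y * (card G / card V))"
proof -
  define t where "t G = ktrace V (arc_kernel V G) (Suc m)" for G
  define \<phi> where "\<phi> G = t G ^ N / real (card G)" for G
  define \<G> where "\<G> = {G. G \<subseteq> F \<and> sym G \<and> G \<noteq> {}}"
  have finF: "finite F" using F fin finite_subset by blast
  have t_nonneg: "t G \<ge> 0" for G unfolding t_def by (intro ktrace_nonneg arc_kernel_nonneg)
  have t_empty: "t {} = 0" by (simp add: t_def ktrace_empty)
  have "F \<in> \<G>" using pos t_empty F by (auto simp: \<G>_def t_def)
  moreover have "finite \<G>" using finF by (simp add: \<G>_def)
  ultimately have "Max (\<phi> ` \<G>) \<in> \<phi> ` \<G>" by (intro Max_in) auto
  then obtain G where G: "G \<in> \<G>" "\<phi> G = Max (\<phi> ` \<G>)" by auto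
  have max: "\<phi> H \<le> \<phi> G" if "H \<in> \<G>" for H
    using that G(2) \<open>finite \<G>\<close> by simp
  have GF: "G \<subseteq> F" and symG: "sym G" and Gne: "G \<noteq> {}" using G(1) by (auto simp: \<G>_def)
  have finG: "finite G" using GF finF finite_subset by blast
  have cG: "card G \<ge> 1" using Gne finG by (simp add: Suc_le_eq card_gt_0_iff)
  have cF: "card F \<ge> 1" using cG card_mono[OF finF GF] by linarith
  have tF: "t F > 0" using pos by (simp add: t_def)
  \<comment> \<open>Passing to \<open>G\<close> costs at most the factor \<open>card F\<close> in
    the \<open>N\<close>-th power of the trace.\<close>
  have "t F ^ N / real (card F) \<le> t G ^ N / real (card G)"
    using max[OF \<open>F \<in> \<G>\<close>] by (simp add: \<phi>_def)
  also have "\<dots> \<le> t G ^ N"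
    using cG t_nonneg[of G] by (simp add: divide_le_eq mult_left_le_one_le mult_le_cancel_left1)
  finally have FG: "t F ^ N \<le> t G ^ N * card F" using cF by (simp add: field_simps)
  have "t G \<noteq> 0"
  proof
    assume "t G = 0"
    then have "t F ^ N \<le> 0" using FG \<open>N \<ge> 1\<close> by (simp add: zero_power)
    then show False using zero_less_power[OF tF, of N] by linarith
  qed
  then have tG: "t G > 0" using t_nonneg[of G] by simp
  have "t G \<le> real (N * Suc m) * (kpow V (arc_kernel V G) m x y * (card G / card V))"
    if xy: "(x, y) \<in> G" for x y
  proof -
    \<comment> \<open>Both orientations go, to keep \<open>H\<close> symmetric. \<open>E\<close> has
      one or two elements, as \<open>x = y\<close> is possible here; the argument treats both cases
      alike through \<open>card E\<close>.\<close>
    define E where "E = {(x, y), (y, x)}"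
    define H where "H = G - E"
    have EG: "E \<subseteq> G" using xy symG by (auto simp: E_def dest: symD)
    have xyV: "x \<in> V" "y \<in> V" using xy GF F by auto
    have symH: "sym H" using symG by (auto simp: H_def E_def sym_def)
    have cH: "real (card H) = real (card G) - real (card E)"
      unfolding H_def using EG finG
      by (subst card_Diff_subset) (auto simp: E_def of_nat_diff card_mono)
    have cE: "card E \<ge> 1" by (simp add: E_def Suc_le_eq card_gt_0_iff)
    have cEG: "card E \<le> card G" using EG finG by (rule card_mono[rotated])
    \<comment> \<open>\<open>b\<close> bounds the relative loss of trace per deleted arc.\<close>
    define b where "b = real (Suc m) * (kpow V (arc_kernel V G) m x y / card V) / t G"
    have "t G - t H \<le> Suc m * (\<Sum>u\<in>V. \<Sum>v\<in>V. (arc_kernel V G u v - arc_kernel V H u v) *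
        kpow V (arc_kernel V G) m v u)"
      unfolding t_def
      by (intro ktrace_diff_le fin arc_kernel_nonneg arc_kernel_mono) (auto simp: H_def)
    also have "(\<Sum>u\<in>V. \<Sum>v\<in>V. (arc_kernel V G u v - arc_kernel V H u v) *
        kpow V (arc_kernel V G) m v u) =
        (\<Sum>u\<in>V. \<Sum>v\<in>V. if (u, v) \<in> E then 1 / card V * kpow V (arc_kernel V G) m v u else 0)"
      by (intro sum.cong refl) (use EG in \<open>auto simp: arc_kernel_def H_def\<close>)
    also have "\<dots> = (\<Sum>(u, v)\<in>E. 1 / card V * kpow V (arc_kernel V G) m v u)"
      by (rule sum_arcs[OF fin]) (use EG GF F in auto)
    also have "\<dots> = (\<Sum>p\<in>E. 1 / card V * kpow V (arc_kernel V G) m x y)"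
      by (intro sum.cong refl)
        (auto simp: E_def kpow_sym[where K = "arc_kernel V G", OF fin arc_kernel_sym[OF symG] xyV])
    also have "real (Suc m) * \<dots> = t G * (card E * b)"
      using tG by (simp add: b_def)
    finally have tH: "t H \<ge> t G * (1 - card E * b)" by (simp add: algebra_simps)
    have b0: "b \<ge> 0"
      unfolding b_def using t_nonneg[of G]
      by (intro divide_nonneg_nonneg mult_nonneg_nonneg kpow_nonneg arc_kernel_nonneg) auto
    \<comment> \<open>A large loss makes this trivial. Otherwise \<open>H\<close> still has positive
      trace, hence is a nonempty competitor, and maximality of \<open>G\<close> together with
      Bernoulli's inequality gives the bound.\<close>
    have "real (card E) / card G \<le> N * (card E * b)"
    proof (cases "card E * b \<ge> 1")
      case True
      have "real (card E) / card G \<le> 1" using cEG cG by (simp add: field_simps)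
      also have "1 \<le> N * (card E * b)"
        using True \<open>N \<ge> 1\<close> mult_mono[of 1 "real N" 1 "card E * b"] by simp
      finally show ?thesis .
    next
      case False
      have "H \<noteq> {}"
      proof
        assume "H = {}"
        with tH t_empty have "t G * (1 - card E * b) \<le> 0" by simp
        with False tG show False by (simp add: mult_le_0_iff)
      qed
      then have "H \<in> \<G>" using symH GF by (auto simp: \<G>_def H_def)
      from max[OF this] have "t H ^ N / card H \<le> t G ^ N / card G" by (simp add: \<phi>_def)
      moreover have "card H > 0"
        using \<open>H \<noteq> {}\<close> finG by (auto simp: H_def card_gt_0_iff)
      ultimately have "t H ^ N \<le> t G ^ N * (card H / card G)"
        using cG by (simp add: field_simps)
      moreover have "(t G * (1 - card E * b)) ^ N \<le> t H ^ N"
        using tH False tG by (intro power_mono) auto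
      ultimately have "t G ^ N * (1 - card E * b) ^ N \<le> t G ^ N * (card H / card G)"
        by (simp add: power_mult_distrib)
      then have "(1 - card E * b) ^ N \<le> card H / card G"
        using tG by (simp only: mult_le_cancel_left_pos zero_less_power)
      moreover have "1 - N * (card E * b) \<le> (1 - card E * b) ^ N"
        using Bernoulli_inequality[of "- (card E * b)" N] False by simp
      moreover have "card H / card G = 1 - card E / card G"
        using cG cH by (simp add: field_simps)
      ultimately show ?thesis by linarith
    qed
    then have "real (card E) * (1 / card G) \<le> real (card E) * (N * b)"
      by (simp add: algebra_simps)
    then have "1 / card G \<le> N * b"
      using cE by (subst (asm) mult_le_cancel_left_pos) auto
    then have "1 \<le> N * b * card G" using cG by (simp add: field_simps)
    then have "t G \<le> N * (b * t G) * card G"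
      using tG mult_right_mono[of 1 "N * b * card G" "t G"] by (simp add: algebra_simps)
    also have "b * t G = real (Suc m) * (kpow V (arc_kernel V G) m x y / card V)"
      using tG by (simp add: b_def)
    finally show ?thesis by (simp add: algebra_simps)
  qed
  with that[of G] GF symG tG FG show ?thesis by (simp add: t_def)
qed

text \<open>The number \<open>z\<close> is the trace of the regular subgraph, whose regularity is
  1/(N(2l + 1)); monotonicity of traces returns the conclusion to \<open>F\<close>. The losses are a
  factor quadratic in the number of vertices, shared by \<open>N\<close> powers, and a term
  logarithmic in \<open>N\<close>.\<close>

lemma lossy_bound:
  assumes fin: "finite V" "V \<noteq> {}" and F: "F \<subseteq> V \<times> V" "sym F" and "N \<ge> 1"
    and kl: "k > l" "l \<ge> 1" and pos: "ktrace V (arc_kernel V F) (2 * l + 1) > 0"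
  obtains z where "z > 0"
    and "ktrace V (arc_kernel V F) (2 * l + 1) ^ N \<le> z ^ N * real (card V) ^ 2"
    and "0 < ktrace V (arc_kernel V F) (2 * k + 1)"
    and "- ln (real (N * (2 * l + 1))) + cycle_exponent k l * ln z \<le>
      ln (ktrace V (arc_kernel V F) (2 * k + 1))"
proof -
  have "ktrace V (arc_kernel V F) (Suc (2 * l)) > 0" using pos by simp
  from regular_subgraph[OF fin(1) F \<open>N \<ge> 1\<close> this] obtain G where
    G: "G \<subseteq> F" "sym G" "ktrace V (arc_kernel V G) (Suc (2 * l)) > 0"
    and le: "ktrace V (arc_kernel V F) (Suc (2 * l)) ^ N \<le>
      ktrace V (arc_kernel V G) (Suc (2 * l)) ^ N * card F"
    and reg: "\<And>x y. (x, y) \<in> G \<Longrightarrow> ktrace V (arc_kernel V G) (Suc (2 * l)) \<le>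
      real (N * Suc (2 * l)) * (kpow V (arc_kernel V G) (2 * l) x y * (card G / card V))"
    by blast
  define z where "z = ktrace V (arc_kernel V G) (2 * l + 1)"
  define s where "s = 1 / real (N * (2 * l + 1))"
  have Nl: "real (N * (2 * l + 1)) \<ge> 1"
    using \<open>N \<ge> 1\<close> by (metis mult_le_mono nat_mult_1 of_nat_1 of_nat_mono le_add2)
  have s: "0 < s" "s \<le> 1" using Nl by (simp_all only: s_def divide_le_eq_1 zero_less_divide_iff) auto
  have sumG: "(\<Sum>x\<in>V. \<Sum>y\<in>V. arc_kernel V G x y) = card G / card V"
    unfolding arc_kernel_def using sum_arcs[OF fin(1), of G "\<lambda>_ _. 1 / card V"] G F
    by (auto simp: case_prod_unfold)
  have reg': "s * ktrace V (arc_kernel V G) (2 * l + 1) \<le>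
      kpow V (arc_kernel V G) (2 * l) x y * (\<Sum>x\<in>V. \<Sum>y\<in>V. arc_kernel V G x y)"
    if "arc_kernel V G x y \<noteq> 0" for x y
  proof -
    have "(x, y) \<in> G" using that by (auto simp: arc_kernel_def split: if_splits)
    from reg[OF this] show ?thesis
      unfolding s_def sumG using Nl by (simp add: field_simps)
  qed
  have *: "0 < ktrace V (arc_kernel V G) (2 * k + 1)"
    "ln s + cycle_exponent k l * ln z \<le> ln (ktrace V (arc_kernel V G) (2 * k + 1))"
    unfolding z_def
    by (rule regular_kernel_bound[OF fin _ _ kl s]; use G reg' in
        \<open>auto simp: arc_kernel_def dest: symD\<close>)+
  have mono: "ktrace V (arc_kernel V G) q \<le> ktrace V (arc_kernel V F) q" for q
    by (intro ktrace_mono arc_kernel_nonneg arc_kernel_mono G)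
  show ?thesis
  proof (rule that)
    show "z > 0" using G by (simp add: z_def)
    have "card F \<le> card V ^ 2"
      using card_mono[OF _ F(1)] fin by (simp add: card_cartesian_product power2_eq_square)
    then have "real (card F) \<le> real (card V) ^ 2"
      by (metis of_nat_le_iff of_nat_power)
    then have "z ^ N * real (card F) \<le> z ^ N * real (card V) ^ 2"
      using \<open>z > 0\<close> by (intro mult_left_mono) auto
    with le show "ktrace V (arc_kernel V F) (2 * l + 1) ^ N \<le> z ^ N * real (card V) ^ 2"
      by (simp add: z_def)
    show "0 < ktrace V (arc_kernel V F) (2 * k + 1)" using *(1) mono less_le_trans by blast
    have "ln s = - ln (real (N * (2 * l + 1)))"
      unfolding s_def using Nl by (subst ln_div) auto
    moreover have "ln (ktrace V (arc_kernel V G) (2 * k + 1)) \<le>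
        ln (ktrace V (arc_kernel V F) (2 * k + 1))"
      using *(1) mono[of "2 * k + 1"] by simp
    ultimately show "- ln (real (N * (2 * l + 1))) + cycle_exponent k l * ln z \<le>
        ln (ktrace V (arc_kernel V F) (2 * k + 1))"
      using *(2) by linarith
  qed
qed

section \<open>Tensor powers\<close>

definition tensor_verts :: "'a set \<Rightarrow> nat \<Rightarrow> (nat \<Rightarrow> 'a) set" where
  "tensor_verts V N = {..<N} \<rightarrow>\<^sub>E V"

definition tensor_arcs :: "('a \<times> 'a) set \<Rightarrow> 'a set \<Rightarrow> nat \<Rightarrow> ((nat \<Rightarrow> 'a) \<times> (nat \<Rightarrow> 'a)) set" where
  "tensor_arcs F V N = {(f, g) \<in> tensor_verts V N \<times> tensor_verts V N. \<forall>i<N. (f i, g i) \<in> F}"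

lemma finite_tensor_verts: "finite V \<Longrightarrow> finite (tensor_verts V N)"
  by (simp add: tensor_verts_def finite_PiE)

lemma card_tensor_verts: "card (tensor_verts V N) = card V ^ N"
  by (simp add: tensor_verts_def card_PiE)

text \<open>The kernel of the tensor power is the product of the kernels of the coordinates, scaling
  included; expanding a product of sums over tuples carries this over to powers and traces.\<close>

lemma ktrace_tensor:
  assumes fin: "finite V"
  shows "ktrace (tensor_verts V N) (arc_kernel (tensor_verts V N) (tensor_arcs F V N)) m =
    ktrace V (arc_kernel V F) m ^ N"
proof -
  define U where "U = tensor_verts V N"
  define W where "W = arc_kernel V F"
  define W' where "W' = arc_kernel U (tensor_arcs F V N)"
  have W': "W' f g = (\<Prod>i<N. W (f i) (g i))" if "f \<in> U" "g \<in> U" for f g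
  proof (cases "\<forall>i<N. (f i, g i) \<in> F")
    case True
    then show ?thesis
      using that by (simp add: W'_def W_def arc_kernel_def tensor_arcs_def U_def
          card_tensor_verts power_one_over)
  next
    case False
    then obtain i where "i < N" "(f i, g i) \<notin> F" by blast
    then have "(\<Prod>i<N. W (f i) (g i)) = 0"
      by (intro prod_zero) (auto simp: W_def arc_kernel_def)
    moreover have "W' f g = 0" using False by (auto simp: W'_def arc_kernel_def tensor_arcs_def)
    ultimately show ?thesis by simp
  qed
  have sum_U: "(\<Sum>h\<in>U. \<Prod>i<N. p i (h i)) = (\<Prod>i<N. \<Sum>z\<in>V. p i z)"
    for p :: "nat \<Rightarrow> 'a \<Rightarrow> real"
    unfolding U_def tensor_verts_def by (rule prod_sum_PiE[symmetric]) (use fin in auto)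
  have pow: "kpow U W' m f g = (\<Prod>i<N. kpow V W m (f i) (g i))" if "f \<in> U" "g \<in> U" for f g
    using that
  proof (induction m arbitrary: f g)
    case 0
    show ?case
    proof (cases "f = g")
      case False
      then obtain i where "i < N" "f i \<noteq> g i"
        using 0 unfolding U_def tensor_verts_def by (metis PiE_ext lessThan_iff)
      then have "(\<Prod>i<N. kpow V W 0 (f i) (g i)) = 0" by (intro prod_zero) auto
      with False show ?thesis by simp
    qed simp
  next
    case (Suc m)
    have "kpow U W' (Suc m) f g =
        (\<Sum>h\<in>U. \<Prod>i<N. W (f i) (h i) * kpow V W m (h i) (g i))"
      using Suc by (simp add: W' prod.distrib)
    also have "\<dots> = (\<Prod>i<N. \<Sum>z\<in>V. W (f i) z * kpow V W m z (g i))"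
      by (rule sum_U)
    finally show ?case by simp
  qed
  have "ktrace U W' m = (\<Sum>f\<in>U. \<Prod>i<N. kpow V W m (f i) (f i))"
    unfolding ktrace_def by (intro sum.cong refl pow)
  also have "\<dots> = ktrace V W m ^ N" using sum_U[of "\<lambda>i z. kpow V W m z z"] by (simp add: ktrace_def)
  finally show ?thesis by (simp add: U_def W_def W'_def)
qed

lemma cycle_exponent_nonneg:
  assumes "k > l" "l \<ge> 1"
  shows "cycle_exponent k l \<ge> 0"
proof -
  have "2 * real q * (2 * real k - 2 * real l + 1) - 1 \<ge> 0" if "q \<ge> 1" for q
    using mult_mono[of 1 "2 * real q" 1 "2 * real k - 2 * real l + 1"] that assms by simp
  then show ?thesis using assms by (auto simp: cycle_exponent_def intro!: divide_nonneg_nonneg)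
qed

text \<open>\<open>lossy_bound\<close> is applied to the \<open>N\<close>-th tensor power, with the
  same \<open>N\<close> as its exponent. After division by \<open>N\<close> the losses are of order
  (ln N)/N and 1/N and vanish in the limit.\<close>

theorem ktrace_odd_domination:
  assumes fin: "finite V" "V \<noteq> {}" and F: "F \<subseteq> V \<times> V" "sym F"
    and kl: "k > l" "l \<ge> 1"
  shows "ktrace V (arc_kernel V F) (2 * l + 1) powr cycle_exponent k l \<le>
    ktrace V (arc_kernel V F) (2 * k + 1)"
proof (cases "ktrace V (arc_kernel V F) (2 * l + 1) > 0")
  case False
  then have "ktrace V (arc_kernel V F) (2 * l + 1) = 0"
    using ktrace_nonneg[where V = V and K = "arc_kernel V F" and n = "2 * l + 1", OF arc_kernel_nonneg]
    by linarith
  then show ?thesis by (simp add: ktrace_nonneg[OF arc_kernel_nonneg])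
next
  case True
  define C where "C = ktrace V (arc_kernel V F) (2 * l + 1)"
  define X where "X = ktrace V (arc_kernel V F) (2 * k + 1)"
  define n where "n = real (card V)"
  define c where "c = cycle_exponent k l"
  have n: "n > 0" using fin by (simp add: n_def card_gt_0_iff)
  have C: "C > 0" using True by (simp add: C_def)
  have c: "c \<ge> 0" using cycle_exponent_nonneg[OF kl] by (simp add: c_def)
  have X0: "X \<ge> 0" unfolding X_def by (intro ktrace_nonneg arc_kernel_nonneg)
  have key: "X > 0 \<and> - (ln (real N) / real N) - (ln (2 * real l + 1) + 2 * c * ln n) / real N +
      c * ln C \<le> ln X" if N: "N \<ge> 1" for N
  proof -
    define U where "U = tensor_verts V N"
    have U: "finite U" "U \<noteq> {}" using fin
      by (auto simp: U_def finite_tensor_verts) (auto simp: tensor_verts_def PiE_eq_empty_iff)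
    have A: "tensor_arcs F V N \<subseteq> U \<times> U" "sym (tensor_arcs F V N)"
      using F(2) by (auto simp: tensor_arcs_def U_def sym_def)
    have "ktrace U (arc_kernel U (tensor_arcs F V N)) (2 * l + 1) > 0"
      unfolding U_def ktrace_tensor[OF fin(1)] using True by simp
    from lossy_bound[OF U A N kl this] obtain z where z: "z > 0" "(C ^ N) ^ N \<le> z ^ N * (n ^ N)\<^sup>2"
      "X ^ N > 0" "- ln (real (N * (2 * l + 1))) + c * ln z \<le> ln (X ^ N)"
      unfolding U_def ktrace_tensor[OF fin(1)] card_tensor_verts C_def X_def n_def c_def
      by (metis of_nat_power)
    have X: "X > 0" using z(3) X0 N by (metis less_le less_numeral_extra(3) zero_power not_one_le_zero neq0_conv)
    have "(C ^ N) ^ N \<le> (z * n\<^sup>2) ^ N"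
      using z(2) by (simp add: power_mult_distrib power_mult[symmetric] mult.commute)
    \<comment> \<open>The tensor power has n^N vertices, so the \<open>N\<close>-th root reduces the
      vertex factor to n^2, independent of \<open>N\<close>.\<close>
    then have "C ^ N \<le> z * n\<^sup>2"
      using N z(1) n by (subst (asm) power_mono_iff) (use C in auto)
    then have "ln (C ^ N) \<le> ln (z * n\<^sup>2)"
      using C z n by (subst ln_le_cancel_iff) auto
    then have "N * ln C - 2 * ln n \<le> ln z"
      using C z n by (simp add: ln_realpow ln_mult)
    then have "c * (N * ln C - 2 * ln n) \<le> c * ln z" using c by (rule mult_left_mono)
    moreover have "ln (real (N * (2 * l + 1))) = ln (real N) + ln (2 * real l + 1)"
    proof -
      have "real (N * (2 * l + 1)) = real N * (2 * real l + 1)" by (simp add: algebra_simps)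
      then show ?thesis using N ln_mult_pos[of "real N" "2 * real l + 1"] by (simp only:)
    qed
    ultimately have "- ln (real N) - (ln (2 * real l + 1) + 2 * c * ln n) + N * (c * ln C) \<le> N * ln X"
      using z(4) X by (simp add: ln_realpow algebra_simps)
    then have "(- ln (real N) - (ln (2 * real l + 1) + 2 * c * ln n) + N * (c * ln C)) / N \<le> ln X"
      using N by (simp add: divide_le_eq mult.commute)
    moreover have "(- ln (real N) - (ln (2 * real l + 1) + 2 * c * ln n) + N * (c * ln C)) / N =
        - (ln (real N) / real N) - (ln (2 * real l + 1) + 2 * c * ln n) / real N + c * ln C"
      using N by (simp add: add_divide_distrib diff_divide_distrib)
    ultimately show ?thesis using X by simp
  qed
  have X: "X > 0" using key[of 1] by simp
  have "(\<lambda>N. - (ln (real N) / real N) - (ln (2 * real l + 1) + 2 * c * ln n) / real N + c * ln C)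
      \<longlonglongrightarrow> - 0 - 0 + c * ln C"
    by (intro tendsto_intros lim_const_over_n
        filterlim_compose[OF ln_x_over_x_tendsto_0 filterlim_real_sequentially])
  then have "- 0 - 0 + c * ln C \<le> ln X"
    by (rule tendsto_upperbound) (use key in \<open>auto intro!: eventually_sequentiallyI[of 1]\<close>)
  then have "C powr c \<le> X"
    using C X by (simp add: powr_def) (metis exp_le_cancel_iff exp_ln)
  then show ?thesis by (simp add: C_def X_def c_def)
qed

section \<open>Homomorphism densities of cycles as traces\<close>

lemma sum_PiE_insert:
  assumes "a \<notin> S"
  shows "(\<Sum>f\<in>Pi\<^sub>E (insert a S) T. h f) = (\<Sum>g\<in>Pi\<^sub>E S T. \<Sum>y\<in>T a. h (g(a := y)))"
proof -
  have "(\<Sum>f\<in>Pi\<^sub>E (insert a S) T. h f) = (\<Sum>(y, g)\<in>T a \<times> Pi\<^sub>E S T. h (g(a := y)))"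
    unfolding PiE_insert_eq
    by (subst sum.reindex[OF inj_combinator[OF assms]]) (simp add: case_prod_unfold)
  also have "\<dots> = (\<Sum>y\<in>T a. \<Sum>g\<in>Pi\<^sub>E S T. h (g(a := y)))"
    by (simp add: sum.cartesian_product)
  also have "\<dots> = (\<Sum>g\<in>Pi\<^sub>E S T. \<Sum>y\<in>T a. h (g(a := y)))"
    by (rule sum.swap)
  finally show ?thesis .
qed

text \<open>The weight \<open>g\<close> of the two endpoints is arbitrary so that the induction can
  absorb the last step of the walk into it; later it closes the walk to a cycle.\<close>

lemma sum_walks_eq_kpow:
  assumes fin: "finite V"
  shows "(\<Sum>f\<in>{..<Suc n} \<rightarrow>\<^sub>E V. (\<Prod>i<n. K (f i) (f (Suc i))) * g (f 0) (f n)) =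
    (\<Sum>x\<in>V. \<Sum>y\<in>V. kpow V K n x y * g x y)"
proof (induction n arbitrary: g)
  case 0
  have "(\<Sum>f\<in>{..<Suc 0} \<rightarrow>\<^sub>E V. g (f 0) (f 0)) = (\<Sum>x\<in>V. g x x)"
    by (simp add: lessThan_Suc sum_PiE_insert)
  moreover have "(\<Sum>y\<in>V. kpow V K 0 x y * g x y) = g x x" if "x \<in> V" for x
  proof -
    have "(\<Sum>y\<in>V. kpow V K 0 x y * g x y) = (\<Sum>y\<in>V. if x = y then g x y else 0)"
      by (intro sum.cong refl) simp
    then show ?thesis using that fin by simp
  qed
  ultimately show ?case by simp
next
  case (Suc n)
  have "(\<Sum>f\<in>{..<Suc (Suc n)} \<rightarrow>\<^sub>E V. (\<Prod>i<Suc n. K (f i) (f (Suc i))) * g (f 0) (f (Suc n))) =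
      (\<Sum>f\<in>{..<Suc n} \<rightarrow>\<^sub>E V. \<Sum>y\<in>V. (\<Prod>i<n. K (f i) (f (Suc i))) * (K (f n) y * g (f 0) y))"
    unfolding lessThan_Suc[of "Suc n"]
    by (subst sum_PiE_insert) (auto intro!: sum.cong simp: mult.assoc)
  also have "\<dots> = (\<Sum>f\<in>{..<Suc n} \<rightarrow>\<^sub>E V. (\<Prod>i<n. K (f i) (f (Suc i))) *
      (\<Sum>y\<in>V. K (f n) y * g (f 0) y))"
    by (simp add: sum_distrib_left)
  also have "\<dots> = (\<Sum>x\<in>V. \<Sum>z\<in>V. kpow V K n x z * (\<Sum>y\<in>V. K z y * g x y))"
    by (rule Suc.IH)
  also have "\<dots> = (\<Sum>x\<in>V. \<Sum>y\<in>V. kpow V K (Suc n) x y * g x y)"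
  proof (rule sum.cong[OF refl])
    fix x assume x: "x \<in> V"
    have "(\<Sum>z\<in>V. kpow V K n x z * (\<Sum>y\<in>V. K z y * g x y)) =
        (\<Sum>z\<in>V. \<Sum>y\<in>V. kpow V K n x z * K z y * g x y)"
      by (simp add: sum_distrib_left mult.assoc)
    also have "\<dots> = (\<Sum>y\<in>V. \<Sum>z\<in>V. kpow V K n x z * K z y * g x y)"
      by (rule sum.swap)
    also have "\<dots> = (\<Sum>y\<in>V. kpow V K (Suc n) x y * g x y)"
    proof (intro sum.cong refl)
      fix y assume y: "y \<in> V"
      have "kpow V K (Suc n) x y = (\<Sum>z\<in>V. kpow V K n x z * K z y)"
        using kpow_add[OF fin x, of K n "Suc 0" y] kpow_1[OF fin y, of K] by (simp del: kpow.simps)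
      then show "(\<Sum>z\<in>V. kpow V K n x z * K z y * g x y) = kpow V K (Suc n) x y * g x y"
        by (simp add: sum_distrib_right del: kpow.simps)
    qed
    finally show "(\<Sum>z\<in>V. kpow V K n x z * (\<Sum>y\<in>V. K z y * g x y)) =
        (\<Sum>y\<in>V. kpow V K (Suc n) x y * g x y)" .
  qed
  finally show ?case .
qed

lemma pair_graph_arcs:
  assumes "pair_graph T"
  shows "finite (pverts T)" "parcs T \<subseteq> pverts T \<times> pverts T" "sym (parcs T)"
proof -
  interpret pair_graph T by (rule assms)
  show "finite (pverts T)" by (rule pair_finite_verts)
  show "parcs T \<subseteq> pverts T \<times> pverts T"
    by (auto dest: arc_fst_in_verts arc_snd_in_verts)
  show "sym (parcs T)" using sym_arcs by (simp add: symmetric_def)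
qed

lemma hom_density_cycle_graph:
  assumes T: "pair_graph T" and "m \<ge> 1"
  shows "hom_density (cycle_graph m) T = ktrace (pverts T) (arc_kernel (pverts T) (parcs T)) m"
proof -
  define V where "V = pverts T"
  define F where "F = parcs T"
  define A :: "'a \<Rightarrow> 'a \<Rightarrow> real" where "A x y = (if (x, y) \<in> F then 1 else 0)" for x y
  have fin: "finite V" and F: "F \<subseteq> V \<times> V" "sym F"
    using pair_graph_arcs[OF T] by (simp_all add: V_def F_def)
  obtain q where m: "m = Suc q" using \<open>m \<ge> 1\<close> by (cases m) auto
  \<comment> \<open>Arcs come in opposite pairs, so by symmetry of \<open>F\<close> one condition
    per index suffices.\<close>
  have homs: "graph_homs (cycle_graph m) T =
      {f \<in> {..<m} \<rightarrow>\<^sub>E V. \<forall>i<m. (f i, f (Suc i mod m)) \<in> F}"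
  proof -
    have "(\<forall>(u, v)\<in>parcs (cycle_graph m). (f u, f v) \<in> F) \<longleftrightarrow>
        (\<forall>i<m. (f i, f (Suc i mod m)) \<in> F)" for f
    proof
      assume *: "\<forall>(u, v)\<in>parcs (cycle_graph m). (f u, f v) \<in> F"
      have "(i, Suc i mod m) \<in> parcs (cycle_graph m)" if "i < m" for i
        using that by (simp add: cycle_graph_def)
      with * show "\<forall>i<m. (f i, f (Suc i mod m)) \<in> F" by blast
    next
      assume "\<forall>i<m. (f i, f (Suc i mod m)) \<in> F"
      then show "\<forall>(u, v)\<in>parcs (cycle_graph m). (f u, f v) \<in> F"
        using F(2) by (auto simp: cycle_graph_def dest: symD)
    qed
    then show ?thesis by (simp add: graph_homs_def V_def F_def cycle_graph_def)
  qed
  have finP: "finite ({..<m} \<rightarrow>\<^sub>E V)" using fin by (simp add: finite_PiE)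
  have ind: "(\<Prod>i<m. A (f i) (f (Suc i mod m))) =
      (if \<forall>i<m. (f i, f (Suc i mod m)) \<in> F then 1 else 0)" for f
  proof (cases "\<forall>i<m. (f i, f (Suc i mod m)) \<in> F")
    case False
    then have "(\<Prod>i<m. A (f i) (f (Suc i mod m))) = 0"
      by (intro prod_zero) (auto simp: A_def)
    with False show ?thesis by auto
  qed (simp add: A_def)
  have "real (hom_count (cycle_graph m) T) =
      (\<Sum>f\<in>{..<m} \<rightarrow>\<^sub>E V. \<Prod>i<m. A (f i) (f (Suc i mod m)))"
    unfolding hom_count_def homs ind using finP by (simp add: sum.If_cases Int_def)
  also have "\<dots> = (\<Sum>f\<in>{..<Suc q} \<rightarrow>\<^sub>E V. (\<Prod>i<q. A (f i) (f (Suc i))) * A (f q) (f 0))"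
    unfolding m by (intro sum.cong refl) (simp add: lessThan_Suc mult.commute)
  also have "\<dots> = (\<Sum>x\<in>V. \<Sum>y\<in>V. kpow V A q x y * A y x)"
    by (rule sum_walks_eq_kpow[OF fin, where g = "\<lambda>x y. A y x"])
  also have "\<dots> = (\<Sum>x\<in>V. \<Sum>y\<in>V. kpow V A q x y * kpow V A (Suc 0) y x)"
    by (intro sum.cong refl) (simp only: kpow_1[OF fin])
  also have "\<dots> = ktrace V A m"
    using ktrace_add[OF fin, of A q "Suc 0"] by (simp add: m del: kpow.simps)
  finally have "real (hom_count (cycle_graph m) T) = ktrace V A m" .
  \<comment> \<open>The scaling of the kernel contributes its \<open>m\<close>-th power to the
    trace, which is the normalisation of the density.\<close>
  moreover have "arc_kernel V F = (\<lambda>x y. 1 / real (card V) * A x y)"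
    by (auto simp: arc_kernel_def A_def fun_eq_iff)
  moreover have "card (pverts (cycle_graph m)) = m" by (simp add: cycle_graph_def)
  ultimately show ?thesis
    unfolding hom_density_def V_def[symmetric] F_def[symmetric]
    by (simp only: ktrace_scale power_one_over) simp
qed

section \<open>The domination exponent is attained\<close>

lemma hom_density_nonneg: "hom_density H T \<ge> 0"
  by (simp add: hom_density_def)

lemma hom_count_le:
  assumes "finite (pverts H)" "finite (pverts T)"
  shows "hom_count H T \<le> card (pverts T) ^ card (pverts H)"
proof -
  have "hom_count H T \<le> card (pverts H \<rightarrow>\<^sub>E pverts T)"
    unfolding hom_count_def using assms
    by (intro card_mono finite_PiE) (auto simp: graph_homs_def)
  then show ?thesis using assms by (simp add: card_PiE)
qed

lemma hom_density_le_1: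
  assumes "finite (pverts H)" "finite (pverts T)"
  shows "hom_density H T \<le> 1"
proof -
  have "real (hom_count H T) \<le> real (card (pverts T)) ^ card (pverts H)"
    using hom_count_le[OF assms] by (metis of_nat_le_iff of_nat_power)
  then show ?thesis
    unfolding hom_density_def by (cases "real (card (pverts T)) ^ card (pverts H) = 0") auto
qed

text \<open>The identity is a homomorphism and a constant map is not. This makes the cycle a target
  that rules out negative exponents.\<close>

lemma hom_density_cycle_self:
  assumes "m \<ge> 3"
  shows "0 < hom_density (cycle_graph m) (cycle_graph m)"
    and "hom_density (cycle_graph m) (cycle_graph m) < 1"
proof -
  let ?C = "cycle_graph m"
  have V: "pverts ?C = {..<m}" by (simp add: cycle_graph_def)
  have fin: "finite ({..<m} \<rightarrow>\<^sub>E {..<m})" by (intro finite_PiE) auto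
  have sub: "graph_homs ?C ?C \<subseteq> {..<m} \<rightarrow>\<^sub>E {..<m}" by (auto simp: graph_homs_def V)
  have "(\<lambda>i\<in>{..<m}. i) \<in> graph_homs ?C ?C"
    by (auto simp: graph_homs_def cycle_graph_def)
  then have "hom_count ?C ?C > 0"
    unfolding hom_count_def using finite_subset[OF sub fin] by (auto simp: card_gt_0_iff)
  then show "0 < hom_density ?C ?C" using assms by (simp add: hom_density_def V)
  have "(\<lambda>i\<in>{..<m}. 0) \<in> {..<m} \<rightarrow>\<^sub>E {..<m}" using assms by auto
  moreover have "(\<lambda>i\<in>{..<m}. 0) \<notin> graph_homs ?C ?C"
  proof
    assume "(\<lambda>i\<in>{..<m}. 0) \<in> graph_homs ?C ?C"
    moreover have "(0, 1) \<in> parcs ?C" using assms by (simp add: cycle_graph_def)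
    ultimately have "((\<lambda>i\<in>{..<m}. 0) 0, (\<lambda>i\<in>{..<m}. 0) 1) \<in> parcs ?C"
      unfolding graph_homs_def by blast
    then show False using assms by (simp add: cycle_graph_def)
  qed
  ultimately have "hom_count ?C ?C < card ({..<m} \<rightarrow>\<^sub>E {..<m})"
    unfolding hom_count_def using sub fin by (intro psubset_card_mono) auto
  then have "hom_count ?C ?C < m ^ m" by (simp add: card_PiE)
  then have "real (hom_count ?C ?C) < real m ^ m" by (metis of_nat_less_iff of_nat_power)
  then show "hom_density ?C ?C < 1" using assms by (simp add: hom_density_def V)
qed

text \<open>\<open>LEAST\<close> on the reals is informative only if the minimum is attained. The
  admissible set is bounded below by 0, since a negative exponent would lift the density in
  \<open>T\<^sub>0\<close> above 1, and it is an intersection of closed sets, so it contains its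
  infimum.\<close>

lemma domination_exponent_le:
  fixes G :: "'a pair_pre_digraph" and H :: "'b pair_pre_digraph" and T\<^sub>0 :: "nat pair_pre_digraph"
  assumes G: "finite (pverts G)"
    and dom: "\<And>T :: nat pair_pre_digraph. pair_graph T \<Longrightarrow> pverts T \<noteq> {} \<Longrightarrow>
      hom_density H T powr c \<le> hom_density G T"
    and T\<^sub>0: "pair_graph T\<^sub>0" "pverts T\<^sub>0 \<noteq> {}" "0 < hom_density H T\<^sub>0" "hom_density H T\<^sub>0 < 1"
  shows "domination_exponent G H \<le> c"
proof -
  define S where "S = {c. \<forall>T :: nat pair_pre_digraph.
     pair_graph T \<and> pverts T \<noteq> {} \<longrightarrow> hom_density G T \<ge> hom_density H T powr c}"
  have c: "c \<in> S" using dom by (simp add: S_def)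
  have "b \<ge> 0" if "b \<in> S" for b
  proof (rule ccontr)
    assume "\<not> b \<ge> 0"
    then have "1 < hom_density H T\<^sub>0 powr b"
      using T\<^sub>0 powr_less_mono2_neg[of b "hom_density H T\<^sub>0" 1] by simp
    also have "\<dots> \<le> hom_density G T\<^sub>0" using that T\<^sub>0 by (simp add: S_def)
    also have "\<dots> \<le> 1"
      using G pair_graph_arcs(1)[OF T\<^sub>0(1)] by (rule hom_density_le_1)
    finally show False by simp
  qed
  then have bdd: "bdd_below S" by (meson bdd_belowI)
  have "S = (\<Inter>T \<in> {T :: nat pair_pre_digraph. pair_graph T \<and> pverts T \<noteq> {}}.
      {c. hom_density H T powr c \<le> hom_density G T})"
    by (auto simp: S_def)
  moreover have "closed {c. hom_density H T powr c \<le> hom_density G T}"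
    for T :: "nat pair_pre_digraph"
  \<comment> \<open>At density 0 every exponent qualifies, as \<open>0 powr c = 0\<close>; otherwise
    the power is continuous in the exponent.\<close>
  proof (cases "hom_density H T = 0")
    case True
    then show ?thesis by (simp add: hom_density_nonneg)
  next
    case False
    then show ?thesis by (intro closed_Collect_le continuous_intros) auto
  qed
  ultimately have "closed S" by auto
  then have "Inf S \<in> S" using c bdd by (intro closed_contains_Inf) auto
  moreover have "Inf S \<le> b" if "b \<in> S" for b using that bdd by (rule cInf_lower)
  ultimately have "domination_exponent G H = Inf S"
    unfolding domination_exponent_def S_def by (intro Least_equality) auto
  then show ?thesis using cInf_lower[OF c bdd] by simp
qed

theorem theorem4p6:
  fixes k l :: nat
  assumes "k > l" and "l \<ge> 1"
  shows "domination_exponent (cycle_graph (2 * k + 1)) (cycle_graph (2 * l + 1)) \<le>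
    (if k \<le> 2 * l - 1
     then 2 * (real k + 1) / (2 * real l + 1)
     else (2 * real k * (2 * real k - 2 * real l + 1) - 1) /
          (2 * real l * (2 * real k - 2 * real l + 1) - 1))"
proof -
  let ?H = "cycle_graph (2 * l + 1)"
  have m: "2 * l + 1 \<ge> 3" using assms by simp
  have "domination_exponent (cycle_graph (2 * k + 1)) ?H \<le> cycle_exponent k l"
  proof (rule domination_exponent_le[where T\<^sub>0 = ?H])
    fix T :: "nat pair_pre_digraph"
    assume T: "pair_graph T" "pverts T \<noteq> {}"
    show "hom_density ?H T powr cycle_exponent k l \<le> hom_density (cycle_graph (2 * k + 1)) T"
      using ktrace_odd_domination[OF pair_graph_arcs(1)[OF T(1)] T(2) pair_graph_arcs(2,3)[OF T(1)]
          assms]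
      by (simp add: hom_density_cycle_graph[OF T(1)])
  qed (use m hom_density_cycle_self[OF m] pair_graph_cycle_graph[OF m] in
      \<open>auto simp: cycle_graph_def\<close>)
  then show ?thesis by (simp add: cycle_exponent_def)
qed

end
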